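(* Let $(\mathcal T,d)$ be a three-dimensional sphere packing triangulation, with finitely many simplices, of a connected manifold. Then the Laplacian matrix $L$ is negative semidefinite with nullspace spanned by the constant vectors.
   Context: $\mathcal T_k$ denotes the set of $k$-simplices of a triangulation $\mathcal T$ of a 3-dimensional manifold. A sphere packing triangulation is given by $r:\mathcal T_0\to(0,\infty)$ such that, with $d_{ij}=r_i$ for every directed edge $(i,j)$, the lengths $\ell_{ij}=d_{ij}+d_{ji}=r_i+r_j$ make every simplex of $\mathcal T$ a nondegenerate Euclidean simplex. Each simplex $\sigma$ has a center $C(\sigma)$ in the affine span of its Euclidean realization: $C(\{i,j\})$ is the point of the edge at distance $d_{ij}$ from $i$, and, for $m=2,3$, $C(\sigma^m)$ is the unique point lying on all the hyperplanes (of the $m$-dimensional span of $\sigma^m$) through $C(\{i,j\})$ perpendicular to $\{i,j\}$, for edges $\{i,j\}$ of $\sigma^m$. For $\sigma^{j}\subset\sigma^{j+1}$, the signed distance $d_\pm[C(\sigma^j),C(\sigma^{j+1})]$ is the Euclidean distance in the span of $\sigma^{j+1}$, with positive sign if $C(\sigma^{j+1})$ is on the same side of the hyperplane spanned by $\sigma^j$ as $\sigma^{j+1}$ and negative sign otherwise. The signed dual area of an edge is $$|\bigstar\{i,j\}|=\frac12\sum_{\{i,j\}\subset\sigma^2\subset\sigma^3}d_\pm[C(\{i,j\}),C(\sigma^2)]\;d_\pm[C(\sigma^2),C(\sigma^3)],$$ the sum being over all pairs $\sigma^2\in\mathcal T_2$, $\sigma^3\in\mathcal T_3$ with $\{i,j\}\subset\sigma^2\subset\sigma^3$.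 We write $|\{i,j\}|=\ell_{ij}$. The matrix $L$, indexed by the vertices $\mathcal T_0$, has $L_{ij}=\frac{|\bigstar\{i,j\}|}{|\{i,j\}|}$ for $\{i,j\}\in\mathcal T_1$, $L_{ij}=0$ for $i\ne j$ with $\{i,j\}\notin\mathcal T_1$, and $L_{ii}=-\sum_{j:\{i,j\}\in\mathcal T_1}\frac{|\bigstar\{i,j\}|}{|\{i,j\}|}$. *)

theory Defs
  imports "HOL-Analysis.Analysis"
begin

section \<open>Triangulated manifolds\<close>

definition topological_manifold :: "nat \<Rightarrow> 'm topology \<Rightarrow> bool" where
  "topological_manifold n X \<longleftrightarrow>
     Hausdorff_space X \<and>
     second_countable X \<and>
     (\<forall>x \<in> topspace X. \<exists>U V. openin X U \<and> x \<in> U \<and> openin (Euclidean_space n) V \<and>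
        subtopology X U homeomorphic_space subtopology (Euclidean_space n) V)"

text \<open>
  A finite simplicial complex is given combinatorially, as a family of sets of vertices.
  Its vertex set is the whole finite type \<open>'v\<close>, so that matrices indexed by the vertices
  have type \<open>real^'v^'v\<close>.
\<close>

definition vertex_complex :: "'v::finite set set \<Rightarrow> bool" where
  "vertex_complex T \<longleftrightarrow>
     {} \<notin> T \<and> (\<forall>v. {v} \<in> T) \<and> (\<forall>\<sigma>\<in>T. \<forall>\<tau>. \<tau> \<subseteq> \<sigma> \<and> \<tau> \<noteq> {} \<longrightarrow> \<tau> \<in> T)"

definition simplices :: "'v::finite set set \<Rightarrow> nat \<Rightarrow> 'v set set" where
  "simplices T k = {\<sigma> \<in> T. card \<sigma> = Suc k}"

definition polyhedron_of :: "'v::finite set set \<Rightarrow> (real^'v) set" where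
  "polyhedron_of T = (\<Union>\<sigma>\<in>T. convex hull ((\<lambda>v. axis v 1) ` \<sigma>))"

definition triangulates :: "'v::finite set set \<Rightarrow> 'm topology \<Rightarrow> bool" where
  "triangulates T M \<longleftrightarrow> vertex_complex T \<and> top_of_set (polyhedron_of T) homeomorphic_space M"


section \<open>Sphere packing triangulations\<close>

definition edge_length :: "('v \<Rightarrow> 'v \<Rightarrow> real) \<Rightarrow> 'v \<Rightarrow> 'v \<Rightarrow> real" where
  "edge_length d i j = d i j + d j i"

text \<open>
  The vertices of a nondegenerate Euclidean simplex with the prescribed edge lengths. The ambient
  space \<open>real^3\<close> accommodates every simplex of dimension at most three.
\<close>

definition euclidean_simplex :: "('v \<Rightarrow> 'v \<Rightarrow> real) \<Rightarrow> 'v set \<Rightarrow> ('v \<Rightarrow> real^3) \<Rightarrow> bool" where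
  "euclidean_simplex d \<sigma> p \<longleftrightarrow>
     inj_on p \<sigma> \<and> \<not> affine_dependent (p ` \<sigma>) \<and>
     (\<forall>i\<in>\<sigma>. \<forall>j\<in>\<sigma>. i \<noteq> j \<longrightarrow> dist (p i) (p j) = edge_length d i j)"

definition sphere_packing :: "'v::finite set set \<Rightarrow> ('v \<Rightarrow> 'v \<Rightarrow> real) \<Rightarrow> bool" where
  "sphere_packing T d \<longleftrightarrow>
     (\<exists>r. (\<forall>v. 0 < r v) \<and> (\<forall>i j. {i, j} \<in> simplices T 1 \<longrightarrow> d i j = r i)) \<and>
     (\<forall>\<sigma>\<in>T. \<exists>p. euclidean_simplex d \<sigma> p)"


section \<open>Centers and signed dual areas\<close>

definition edge_center ::
  "('v \<Rightarrow> 'v \<Rightarrow> real) \<Rightarrow> ('v \<Rightarrow> real^3) \<Rightarrow> 'v \<Rightarrow> 'v \<Rightarrow> real^3" where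
  "edge_center d p i j = (THE c. c \<in> closed_segment (p i) (p j) \<and> dist (p i) c = d i j)"

text \<open>
  Inside the affine hull of the simplex, the point lying on all the hyperplanes that are
  perpendicular to the edges at their centers. For a single edge the hyperplane is the
  point \<open>edge_center d p i j\<close> itself, so the same formula gives the center of an edge.
\<close>

definition simplex_center ::
  "('v \<Rightarrow> 'v \<Rightarrow> real) \<Rightarrow> ('v \<Rightarrow> real^3) \<Rightarrow> 'v set \<Rightarrow> real^3" where
  "simplex_center d p \<sigma> =
     (THE c. c \<in> affine hull (p ` \<sigma>) \<and>
        (\<forall>i\<in>\<sigma>. \<forall>j\<in>\<sigma>. i \<noteq> j \<longrightarrow> (c - edge_center d p i j) \<bullet> (p j - p i) = 0))"

text \<open>
  The simplex \<open>\<tau>\<close>, of which \<open>\<sigma>\<close> is a facet, lies on the side of the hyperplane spanned by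
  \<open>\<sigma>\<close> that contains the vertex opposite to \<open>\<sigma>\<close>. Two points are on the same open side iff the
  segment joining them misses the hyperplane. If the center of \<open>\<tau>\<close> is on the hyperplane, it
  coincides with the center of \<open>\<sigma>\<close> and the sign is irrelevant.
\<close>

definition same_side ::
  "('v \<Rightarrow> 'v \<Rightarrow> real) \<Rightarrow> ('v \<Rightarrow> real^3) \<Rightarrow> 'v set \<Rightarrow> 'v set \<Rightarrow> bool" where
  "same_side d p \<sigma> \<tau> \<longleftrightarrow>
     (\<forall>v \<in> \<tau> - \<sigma>. closed_segment (simplex_center d p \<tau>) (p v) \<inter> affine hull (p ` \<sigma>) = {})"

text \<open>
  The signed distance is computed in a realization of \<open>\<tau>\<close>; it does not depend on which one,
  as any two differ by an isometry.
\<close>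

definition signed_dist :: "('v \<Rightarrow> 'v \<Rightarrow> real) \<Rightarrow> 'v set \<Rightarrow> 'v set \<Rightarrow> real" where
  "signed_dist d \<sigma> \<tau> =
     (let p = (SOME p. euclidean_simplex d \<tau> p)
      in (if same_side d p \<sigma> \<tau> then 1 else - 1) * dist (simplex_center d p \<sigma>) (simplex_center d p \<tau>))"

definition dual_area ::
  "'v::finite set set \<Rightarrow> ('v \<Rightarrow> 'v \<Rightarrow> real) \<Rightarrow> 'v \<Rightarrow> 'v \<Rightarrow> real" where
  "dual_area T d i j =
     (1/2) * (\<Sum>(\<sigma>, \<tau>) \<in> {(\<sigma>, \<tau>). \<sigma> \<in> simplices T 2 \<and> \<tau> \<in> simplices T 3 \<and> {i, j} \<subseteq> \<sigma> \<and> \<sigma> \<subseteq> \<tau>}.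
        signed_dist d {i, j} \<sigma> * signed_dist d \<sigma> \<tau>)"


section \<open>The Laplacian matrix\<close>

definition laplacian :: "'v::finite set set \<Rightarrow> ('v \<Rightarrow> 'v \<Rightarrow> real) \<Rightarrow> real^'v^'v" where
  "laplacian T d = (\<chi> i j.
     if i = j then - (\<Sum>k \<in> {k. {i, k} \<in> simplices T 1}. dual_area T d i k / edge_length d i k)
     else if {i, j} \<in> simplices T 1 then dual_area T d i j / edge_length d i j
     else 0)"

definition negative_semidefinite :: "real^'n^'n \<Rightarrow> bool" where
  "negative_semidefinite A \<longleftrightarrow> transpose A = A \<and> (\<forall>x. x \<bullet> (A *v x) \<le> 0)"

end

theory Submission
  imports Defs
begin

text \<open>
  The quadratic form of the Laplacian is a sum over tetrahedra. In a tetrahedron of mutually tangent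
  spheres with bends \<open>\<kappa>\<^sub>i = 1 / r\<^sub>i\<close>, the centers of the faces and of the tetrahedron are the radical
  centers of the spheres, with explicit barycentric coordinates. For a facet \<open>\<sigma>\<close> of \<open>\<tau>\<close> opposite to
  \<open>v\<close>, the product of the two signed distances at any edge of \<open>\<sigma>\<close> is, up to a positive factor depending
  only on \<open>\<tau>\<close>, the quotient of \<open>\<Sum>\<^sub>i \<kappa>\<^sub>i - 2 \<kappa>\<^sub>v\<close> by the second elementary symmetric polynomial
  of the bends of \<open>\<sigma>\<close>. The resulting form in four variables may have negative coefficients; it is
  definite modulo constants because eliminating one vertex leaves a form on a triangle whose
  coefficients and determinant factor, the positive factors being Descartes' discriminant and
  polynomials that are positive when the discriminant is. Finally, by invariance of dimension every
  edge lies in a tetrahedron, so that a vector in the nullspace is constant along edges, hence constant.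
\<close>

section \<open>The energy form of four mutually tangent spheres\<close>

text \<open>
  Throughout, \<open>a b c t\<close> are the bends (reciprocal radii) of the four spheres. The discriminant
  \<open>soddy\<close> of Descartes' circle theorem is positive iff the tetrahedron is nondegenerate.
  The coefficient of the edge \<open>ab\<close> in the energy of the tetrahedron is \<open>edgewt\<close> below, a positive
  multiple of \<open>a b E\<^sub>a E\<^sub>b wnum a b c t\<close>, where \<open>E\<^sub>v\<close> is the \<open>pairprod\<close> of the face opposite to \<open>v\<close>.
  Then \<open>degnum\<close> is, up to the factor \<open>a E\<^sub>a\<close>, the total coefficient at the vertex \<open>a\<close>, and
  \<open>redwt a b c t\<close> is, up to positive factors, the coefficient of \<open>bc\<close> after elimination of \<open>a\<close>.
\<close>

definition pairprod :: "real \<Rightarrow> real \<Rightarrow> real \<Rightarrow> real" where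
  "pairprod x y z = x * y + x * z + y * z"

definition soddy :: "real \<Rightarrow> real \<Rightarrow> real \<Rightarrow> real \<Rightarrow> real" where
  "soddy a b c t = 2 * (a*b + a*c + a*t + b*c + b*t + c*t) - (a^2 + b^2 + c^2 + t^2)"

definition wnum :: "real \<Rightarrow> real \<Rightarrow> real \<Rightarrow> real \<Rightarrow> real" where
  "wnum a b c t = 2 * a * b + (a + b) * (c + t) - (c - t)^2"

definition degnum :: "real \<Rightarrow> real \<Rightarrow> real \<Rightarrow> real \<Rightarrow> real" where
  "degnum a b c t = b * pairprod a c t * wnum a b c t + c * pairprod a b t * wnum a c b t
     + t * pairprod a b c * wnum a t b c"

definition redwt :: "real \<Rightarrow> real \<Rightarrow> real \<Rightarrow> real \<Rightarrow> real" where
  "redwt a b c t = 3*a*b*c + 3*a*b*t + 3*a*c*t + 3*a*t^2 + 4*b*c*t + 2*b*t^2 + 2*c*t^2 - 2*t^3"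

text \<open>Eliminating the vertex with bend \<open>a\<close> adds to the coefficient of the edge
  \<open>bc\<close> the product of those of \<open>ab\<close> and \<open>ac\<close> divided by the
  total at \<open>a\<close>. With positive factors cleared this is the left side; the identity
  splits off the discriminant and leaves the cubic \<open>redwt\<close>.\<close>

lemma star_mesh:
  "degnum a b c t * wnum b c a t + a * pairprod b c t * wnum a b c t * wnum a c b t
     = pairprod a b c * soddy a b c t * redwt a b c t"
  unfolding degnum_def pairprod_def wnum_def soddy_def redwt_def by algebra

text \<open>Multiplied by \<open>b * c * t\<close>, the left side is the determinant of the triangle
  form that remains after elimination, so the determinant inherits its sign from
  \<open>degnum\<close>.\<close>

lemma redwt_det:
  "b * redwt a b c t * redwt a b t c + c * redwt a b c t * redwt a c t b
     + t * redwt a b t c * redwt a c t b = 6 * pairprod b c t * degnum a b c t"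
  unfolding degnum_def pairprod_def wnum_def redwt_def by algebra

text \<open>Single summands of \<open>degnum\<close> can be negative because \<open>wnum\<close>
  can; the polynomial is therefore rewritten as \<open>soddy\<close> and monomials with positive
  coefficients.\<close>

lemma degnum_pos:
  assumes "0 < a" "0 < b" "0 < c" "0 < t" "0 < soddy a b c t"
  shows "0 < degnum a b c t"
proof -
  have "degnum a b c t = soddy a b c t * (2*b*c*t + a*b*c + a*b*t + a*c*t)
      + a * (a^2 * (b*c + b*t + c*t) + a * (b*c*(b+c) + b*t*(b+t) + c*t*(c+t))
      + 2 * a * b * c * t + b * c * t * (b + c + t))"
    unfolding degnum_def pairprod_def wnum_def soddy_def by algebra
  then show ?thesis
    using assms by (simp add: add_pos_pos)
qed

text \<open>A single \<open>redwt\<close> can be negative. Up to the factor \<open>b\<close>, this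
  sum is the leading coefficient of the reduced triangle form.\<close>

lemma redwt_sum_pos:
  assumes "0 < a" "0 < b" "0 < c" "0 < t" "0 < soddy a b c t"
  shows "0 < c * redwt a b c t + t * redwt a b t c"
proof -
  have "c * redwt a b c t + t * redwt a b t c
      = 2 * c * t * soddy a b c t + 2 * c * t * (a - b)^2 + 3 * a * b * (c + t)^2
        + 2 * c * t * (a + b) * (c + t)"
    unfolding soddy_def redwt_def by algebra
  then show ?thesis
    using assms by (simp add: add_pos_nonneg add_nonneg_pos)
qed

section \<open>Definiteness of the form on one tetrahedron\<close>

text \<open>Completing the square in \<open>x0\<close>; the remainder is a form on a triangle, with
  the coefficients of the star-mesh transformation scaled by \<open>p + q + r\<close>.\<close>

lemma eliminate_vertex:
  fixes p q r u v w x0 x1 x2 x3 :: real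
  shows "(p + q + r) * (p * (x0 - x1)^2 + q * (x0 - x2)^2 + r * (x0 - x3)^2
       + u * (x1 - x2)^2 + v * (x1 - x3)^2 + w * (x2 - x3)^2)
     = (p * (x0 - x1) + q * (x0 - x2) + r * (x0 - x3))^2
       + (((p + q + r) * u + p * q) * (x1 - x2)^2 + ((p + q + r) * v + p * r) * (x1 - x3)^2
         + ((p + q + r) * w + q * r) * (x2 - x3)^2)"
  by algebra

text \<open>Sylvester's criterion for the form in two independent differences: \<open>u + v\<close>
  is the leading minor, the other assumption is the determinant.\<close>

lemma triangle_form_definite:
  fixes u v w x1 x2 x3 :: real
  assumes "0 < u + v" "0 < u * v + u * w + v * w"
  defines "S \<equiv> u * (x1 - x2)^2 + v * (x1 - x3)^2 + w * (x2 - x3)^2"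
  shows "0 \<le> S" and "S \<le> 0 \<Longrightarrow> x1 = x2 \<and> x2 = x3"
proof -
  have eq: "(u + v) * S = (u * (x1 - x2) + v * (x1 - x3))^2 + (u * v + u * w + v * w) * (x2 - x3)^2"
    unfolding S_def by algebra
  have "0 \<le> (u + v) * S"
    unfolding eq using assms(2) by simp
  then show "0 \<le> S"
    using assms(1) by (simp add: zero_le_mult_iff)
  show "x1 = x2 \<and> x2 = x3" if "S \<le> 0"
  proof -
    have "(u + v) * S \<le> 0"
      using that assms(1) by (simp add: mult_le_0_iff)
    then have "(u * (x1 - x2) + v * (x1 - x3))^2 + (u * v + u * w + v * w) * (x2 - x3)^2 = 0"
      unfolding eq using assms(2) by (simp add: antisym)
    then have 0: "u * (x1 - x2) + v * (x1 - x3) = 0 \<and> x2 = x3"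
      using assms(2) by (auto simp: add_nonneg_eq_0_iff)
    then have "(u + v) * (x1 - x2) = 0"
      by algebra
    then show ?thesis
      using assms(1) 0 by simp
  qed
qed

text \<open>In terms of radii, \<open>a * b / (a + b)\<close> is the reciprocal of the edge length.
  Each summand belongs to a face at the edge: the first to the face opposite to \<open>c\<close>,
  the second to the one opposite to \<open>t\<close>.\<close>

definition edgewt :: "real \<Rightarrow> real \<Rightarrow> real \<Rightarrow> real \<Rightarrow> real" where
  "edgewt a b c t = a * b / (a + b) *
     ((a + b + t - c) / pairprod a b t + (a + b + c - t) / pairprod a b c)"

lemma edgewt_eq:
  assumes "0 < a" "0 < b" "0 < c" "0 < t"
  shows "pairprod a b c * pairprod a b t * edgewt a b c t = a * b * wnum a b c t"
proof -
  have pos: "pairprod a b c > 0" "pairprod a b t > 0" "a + b > 0"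
    using assms by (simp_all add: pairprod_def add_pos_pos)
  \<comment> \<open>Over the common denominator the numerator contains the factor
    \<open>a + b\<close>, which cancels the one from the edge length.\<close>
  have num: "(a + b + t - c) * pairprod a b c + (a + b + c - t) * pairprod a b t
      = (a + b) * wnum a b c t"
    unfolding pairprod_def wnum_def by algebra
  have clear: "P * R * (h * (m / R + n / P)) = h * (m * P + n * R)" if "P > 0" "R > 0" for P R h m n :: real
    using that by (simp add: field_simps)
  have "pairprod a b c * pairprod a b t * edgewt a b c t
      = a * b / (a + b) * ((a + b + t - c) * pairprod a b c + (a + b + c - t) * pairprod a b t)"
    unfolding edgewt_def using clear[OF pos(1,2)] .
  also have "\<dots> = a * b * wnum a b c t"
    unfolding num using pos by simp
  finally show ?thesis .
qed

text \<open>After denominators are cleared, \<open>x0\<close> is eliminated; its total coefficient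
  is positive by \<open>degnum_pos\<close>. The remaining triangle form is definite by
  \<open>redwt_sum_pos\<close> and \<open>redwt_det\<close>.\<close>

lemma tetrahedron_form_definite:
  fixes a b c t x0 x1 x2 x3 :: real
  assumes pos: "0 < a" "0 < b" "0 < c" "0 < t" "0 < soddy a b c t"
  defines "Q \<equiv> edgewt a b c t * (x0 - x1)^2 + edgewt a c b t * (x0 - x2)^2
     + edgewt a t b c * (x0 - x3)^2 + edgewt b c a t * (x1 - x2)^2
     + edgewt b t a c * (x1 - x3)^2 + edgewt c t a b * (x2 - x3)^2"
  shows "0 \<le> Q" and "Q \<le> 0 \<Longrightarrow> x0 = x1 \<and> x0 = x2 \<and> x0 = x3"
proof -
  define Ea where "Ea = pairprod b c t"
  define Eb where "Eb = pairprod a c t"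
  define Ec where "Ec = pairprod a b t"
  define Et where "Et = pairprod a b c"
  have E: "0 < Ea" "0 < Eb" "0 < Ec" "0 < Et"
    using pos by (simp_all add: Ea_def Eb_def Ec_def Et_def pairprod_def add_pos_pos)
  define PE where "PE = Ea * Eb * Ec * Et"
  have PE: "0 < PE" using E by (simp add: PE_def)
  define p where "p = a * b * Ea * Eb * wnum a b c t"
  define q where "q = a * c * Ea * Ec * wnum a c b t"
  define r where "r = a * t * Ea * Et * wnum a t b c"
  define u where "u = b * c * Eb * Ec * wnum b c a t"
  define v where "v = b * t * Eb * Et * wnum b t a c"
  define w where "w = c * t * Ec * Et * wnum c t a b"
  have e: "Et * Ec * edgewt a b c t = a * b * wnum a b c t"
      "Et * Eb * edgewt a c b t = a * c * wnum a c b t"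
      "Ec * Eb * edgewt a t b c = a * t * wnum a t b c"
      "Et * Ea * edgewt b c a t = b * c * wnum b c a t"
      "Ec * Ea * edgewt b t a c = b * t * wnum b t a c"
      "Eb * Ea * edgewt c t a b = c * t * wnum c t a b"
    using edgewt_eq[of a b c t] edgewt_eq[of a c b t] edgewt_eq[of a t b c]
      edgewt_eq[of b c a t] edgewt_eq[of b t a c] edgewt_eq[of c t a b] pos
    by (simp_all add: Ea_def Eb_def Ec_def Et_def pairprod_def ac_simps)
  have W: "PE * edgewt a b c t = p" "PE * edgewt a c b t = q" "PE * edgewt a t b c = r"
      "PE * edgewt b c a t = u" "PE * edgewt b t a c = v" "PE * edgewt c t a b = w"
    unfolding PE_def p_def q_def r_def u_def v_def w_def using e by algebra+
  define \<alpha> where "\<alpha> = degnum a b c t"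
  have \<alpha>: "0 < \<alpha>" using degnum_pos[OF pos] by (simp add: \<alpha>_def)
  have sum: "p + q + r = a * Ea * \<alpha>"
    unfolding p_def q_def r_def \<alpha>_def degnum_def Eb_def Ec_def Et_def by algebra
  \<comment> \<open>The positive factor common to the three reduced coefficients, so that only
    \<open>u'\<close>, \<open>v'\<close> and \<open>w'\<close> decide definiteness.\<close>
  define m where "m = PE * soddy a b c t * a"
  have m: "0 < m" using PE pos by (simp add: m_def)
  define u' where "u' = b * c * redwt a b c t"
  define v' where "v' = b * t * redwt a b t c"
  define w' where "w' = c * t * redwt a c t b"
  \<comment> \<open>The common pattern of the three reductions, with the polynomials as atoms. The
    reductions are \<open>star_mesh\<close> for the three permutations of \<open>b\<close>,
    \<open>c\<close>, \<open>t\<close> that single out one edge.\<close>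
  have clear: "e * f * A * (g * h * F * G * n) + e * g * f * F * n1 * (e * h * f * G * n2)
      = f * F * G * H * s * e * (g * h * z)"
    if "A * n + e * f * n1 * n2 = H * s * z" for A e f g h n n1 n2 F G H s z :: real
    using that by algebra
  have "\<alpha> * wnum b c a t + a * Ea * wnum a b c t * wnum a c b t = Et * soddy a b c t * redwt a b c t"
    using star_mesh[of a b c t] by (simp add: \<alpha>_def Ea_def Et_def)
  from clear[OF this, of b c Eb Ec]
  have red1: "(p + q + r) * u + p * q = m * u'"
    unfolding sum unfolding u_def p_def q_def u'_def m_def PE_def by simp
  have "\<alpha> * wnum b t a c + a * Ea * wnum a b c t * wnum a t b c = Ec * soddy a b c t * redwt a b t c"
    using star_mesh[of a b t c]
    by (simp add: \<alpha>_def Ea_def Ec_def degnum_def pairprod_def wnum_def soddy_def power2_commute[of t c] ac_simps)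
  from clear[OF this, of b t Eb Et]
  have red2: "(p + q + r) * v + p * r = m * v'"
    unfolding sum unfolding v_def p_def r_def v'_def m_def PE_def by (simp add: ac_simps)
  have "\<alpha> * wnum c t a b + a * Ea * wnum a c b t * wnum a t b c = Eb * soddy a b c t * redwt a c t b"
    using star_mesh[of a c t b]
    by (simp add: \<alpha>_def Ea_def Eb_def degnum_def pairprod_def wnum_def soddy_def
        power2_commute[of t b] power2_commute[of c b] power2_commute[of t c] ac_simps)
  from clear[OF this, of c t Ec Et]
  have red3: "(p + q + r) * w + q * r = m * w'"
    unfolding sum unfolding w_def q_def r_def w'_def m_def PE_def by (simp add: ac_simps)
  note red = red1 red2 red3
  have "b * c * t * (6 * Ea * \<alpha>) = u' * v' + u' * w' + v' * w'"
    unfolding Ea_def \<alpha>_def u'_def v'_def w'_def redwt_det[symmetric] by algebra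
  then have det: "0 < u' * v' + u' * w' + v' * w'"
    using E \<alpha> pos by (metis mult_pos_pos zero_less_numeral)
  have "u' + v' = b * (c * redwt a b c t + t * redwt a b t c)"
    unfolding u'_def v'_def by algebra
  then have uv: "0 < u' + v'"
    using redwt_sum_pos[OF pos] pos by simp
  define S where "S = u' * (x1 - x2)^2 + v' * (x1 - x3)^2 + w' * (x2 - x3)^2"
  note S = triangle_form_definite[OF uv det, of x1 x2 x3, folded S_def]
  have PEQ: "PE * Q = p * (x0 - x1)^2 + q * (x0 - x2)^2 + r * (x0 - x3)^2
       + u * (x1 - x2)^2 + v * (x1 - x3)^2 + w * (x2 - x3)^2"
    unfolding Q_def W[symmetric] by (simp add: distrib_left mult.assoc)
  have "(p + q + r) * (PE * Q) = (p * (x0 - x1) + q * (x0 - x2) + r * (x0 - x3))^2 + m * S"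
    unfolding PEQ eliminate_vertex red S_def by (simp add: distrib_left mult.assoc)
  then have eq: "(p + q + r) * PE * Q
      = (p * (x0 - x1) + q * (x0 - x2) + r * (x0 - x3))^2 + m * S"
    by (simp add: mult.assoc)
  have pqr: "0 < p + q + r"
    unfolding sum using pos E \<alpha> by simp
  have "0 \<le> (p + q + r) * PE * Q"
    unfolding eq using S(1) m by simp
  then show "0 \<le> Q"
    using pqr PE by (metis mult_pos_pos zero_le_mult_iff not_less)
  show "x0 = x1 \<and> x0 = x2 \<and> x0 = x3" if "Q \<le> 0"
  proof -
    have "(p + q + r) * PE * Q \<le> 0"
      using that pqr PE by (meson mult_nonneg_nonpos mult_pos_pos less_imp_le)
    then have "(p * (x0 - x1) + q * (x0 - x2) + r * (x0 - x3))^2 + m * S \<le> 0"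
      by (simp add: eq)
    moreover have "0 \<le> m * S" using S(1) m by simp
    ultimately have 0: "(p * (x0 - x1) + q * (x0 - x2) + r * (x0 - x3))^2 = 0" "m * S = 0"
      by (smt (verit) zero_le_power2)+
    then have x: "x1 = x2" "x2 = x3" using S m by auto
    have "(p + q + r) * (x0 - x1) = 0"
      using 0(1) x by (simp add: algebra_simps)
    then show ?thesis using pqr x by simp
  qed
qed

section \<open>Centers of simplices spanned by tangent spheres\<close>

text \<open>Leibniz' identity, from polarizing the inner products of \<open>q i - z\<close> and
  \<open>q k - z\<close>. Weights of sum 0 remove the dependence on \<open>z\<close>; weights of sum
  1 give the distance of a barycentric combination from \<open>z\<close>.\<close>

lemma norm_sum_weighted:
  fixes q :: "'i \<Rightarrow> 'a::real_inner"
  assumes "finite \<sigma>"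
  shows "(norm (\<Sum>i\<in>\<sigma>. \<nu> i *\<^sub>R (q i - z)))\<^sup>2
    = sum \<nu> \<sigma> * (\<Sum>i\<in>\<sigma>. \<nu> i * (norm (q i - z))\<^sup>2)
      - (\<Sum>i\<in>\<sigma>. \<Sum>k\<in>\<sigma>. \<nu> i * \<nu> k * (norm (q i - q k))\<^sup>2) / 2"
proof -
  define a where "a i k = (q i - z) \<bullet> (q k - z)" for i k
  have a: "(norm (q i - q k))\<^sup>2 = a i i + a k k - 2 * a i k" for i k
    by (simp add: a_def power2_norm_eq_inner inner_diff_left inner_diff_right inner_commute)
  have 1: "(\<Sum>i\<in>\<sigma>. \<Sum>k\<in>\<sigma>. \<nu> i * \<nu> k * a i i) = sum \<nu> \<sigma> * (\<Sum>i\<in>\<sigma>. \<nu> i * a i i)"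
    by (subst sum.swap) (simp add: sum_product ac_simps)
  have 2: "(\<Sum>i\<in>\<sigma>. \<Sum>k\<in>\<sigma>. \<nu> i * \<nu> k * a k k) = sum \<nu> \<sigma> * (\<Sum>i\<in>\<sigma>. \<nu> i * a i i)"
    by (simp add: sum_product ac_simps)
  have "(norm (\<Sum>i\<in>\<sigma>. \<nu> i *\<^sub>R (q i - z)))\<^sup>2 = (\<Sum>i\<in>\<sigma>. \<Sum>k\<in>\<sigma>. \<nu> i * \<nu> k * a i k)"
    by (simp add: a_def power2_norm_eq_inner inner_sum_left inner_sum_right sum_distrib_left inner_commute ac_simps)
  moreover have "(\<Sum>i\<in>\<sigma>. \<Sum>k\<in>\<sigma>. \<nu> i * \<nu> k * (norm (q i - q k))\<^sup>2)
      = 2 * (sum \<nu> \<sigma> * (\<Sum>i\<in>\<sigma>. \<nu> i * a i i)) - 2 * (\<Sum>i\<in>\<sigma>. \<Sum>k\<in>\<sigma>. \<nu> i * \<nu> k * a i k)"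
  proof -
    have "(\<Sum>i\<in>\<sigma>. \<Sum>k\<in>\<sigma>. \<nu> i * \<nu> k * (norm (q i - q k))\<^sup>2)
        = (\<Sum>i\<in>\<sigma>. \<Sum>k\<in>\<sigma>. \<nu> i * \<nu> k * a i i + \<nu> i * \<nu> k * a k k - 2 * (\<nu> i * \<nu> k * a i k))"
      unfolding a by (simp add: algebra_simps)
    then show ?thesis
      unfolding sum.distrib sum_subtractf 1 2 by (simp add: sum_distrib_left)
  qed
  moreover have "(norm (q i - z))\<^sup>2 = a i i" for i
    by (simp add: a_def power2_norm_eq_inner)
  ultimately show ?thesis by (simp add: diff_divide_distrib)
qed

definition bend_sum :: "('v \<Rightarrow> real) \<Rightarrow> 'v set \<Rightarrow> real" where
  "bend_sum r \<sigma> = (\<Sum>i\<in>\<sigma>. 1 / r i)"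

text \<open>
  For a simplex with \<open>m \<ge> 3\<close> vertices the center has barycentric coordinates proportional to
  \<open>dev r \<sigma> i / r i\<close>, and its distance to every edge is \<open>sqrt (2 / disc r \<sigma>)\<close>.
\<close>

definition dev :: "('v \<Rightarrow> real) \<Rightarrow> 'v set \<Rightarrow> 'v \<Rightarrow> real" where
  "dev r \<sigma> i = bend_sum r \<sigma> / (real (card \<sigma>) - 2) - 1 / r i"

definition disc :: "('v \<Rightarrow> real) \<Rightarrow> 'v set \<Rightarrow> real" where
  "disc r \<sigma> = (\<Sum>i\<in>\<sigma>. dev r \<sigma> i / r i)"

text \<open>
  Common power \<open>t\<close> with respect to all the spheres is equivalent to lying on all the hyperplanes
  that define the center of a simplex.
\<close>

definition radical_center :: "('v \<Rightarrow> real) \<Rightarrow> ('v \<Rightarrow> real^3) \<Rightarrow> 'v set \<Rightarrow> real^3 \<Rightarrow> real \<Rightarrow> bool" where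
  "radical_center r p \<sigma> X t \<longleftrightarrow> X \<in> affine hull (p ` \<sigma>) \<and> (\<forall>i\<in>\<sigma>. (norm (X - p i))\<^sup>2 = (r i)\<^sup>2 + t)"

lemma inner_zero_affine_hull:
  assumes "\<And>i j. i \<in> \<sigma> \<Longrightarrow> j \<in> \<sigma> \<Longrightarrow> w \<bullet> (p i - p j) = (0::real)"
    and "x \<in> affine hull (p ` \<sigma>)" "y \<in> affine hull (p ` \<sigma>)"
  shows "w \<bullet> (x - y) = 0"
proof -
  obtain k where k: "k \<in> \<sigma>"
    using assms(2) by fastforce
  have "affine {z. w \<bullet> z = w \<bullet> p k}"
    by (rule affine_hyperplane)
  moreover have "p ` \<sigma> \<subseteq> {z. w \<bullet> z = w \<bullet> p k}"
    using assms(1)[OF _ k] by (auto simp: inner_diff_right)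
  ultimately have "affine hull (p ` \<sigma>) \<subseteq> {z. w \<bullet> z = w \<bullet> p k}"
    by (rule hull_minimal[rotated])
  with assms(2,3) have "w \<bullet> x = w \<bullet> p k" "w \<bullet> y = w \<bullet> p k"
    by auto
  then show ?thesis by (simp add: inner_diff_right)
qed

text \<open>A difference of squared distances to two fixed points is an affine function; this turns
  equal powers into perpendicularity.\<close>

lemma inner_eq_norm_diff:
  fixes X Y a b :: "'a::real_inner"
  shows "2 * ((X - Y) \<bullet> (a - b))
    = ((norm (X - b))\<^sup>2 - (norm (X - a))\<^sup>2) - ((norm (Y - b))\<^sup>2 - (norm (Y - a))\<^sup>2)"
  by (simp add: power2_norm_eq_inner inner_diff_left inner_diff_right inner_commute algebra_simps)

text \<open>Constant power differences make \<open>Y - X\<close> orthogonal to the span of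
  \<open>\<sigma>\<close>, so Pythagoras applies at any vertex of \<open>\<sigma>\<close>.\<close>

lemma radical_center_dist:
  assumes "\<sigma> \<subseteq> \<tau>" "radical_center r p \<sigma> X t" "radical_center r p \<tau> Y u"
  shows "(dist X Y)\<^sup>2 = u - t"
proof -
  have perp: "(Y - X) \<bullet> (p i - p j) = 0" if "i \<in> \<sigma>" "j \<in> \<sigma>" for i j
    using inner_eq_norm_diff[of Y X "p i" "p j"] that assms subsetD[OF assms(1)]
    by (simp add: radical_center_def)
  have X: "X \<in> affine hull (p ` \<sigma>)"
    using assms by (simp add: radical_center_def)
  then obtain i where i: "i \<in> \<sigma>"
    by fastforce
  then have "(Y - X) \<bullet> (X - p i) = 0"
    using inner_zero_affine_hull[of \<sigma> "Y - X" p X "p i", OF perp X] by (simp add: hull_inc)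
  then have "(norm (Y - p i))\<^sup>2 = (norm (Y - X))\<^sup>2 + (norm (X - p i))\<^sup>2"
    by (simp add: power2_norm_eq_inner inner_diff_left inner_diff_right inner_commute algebra_simps)
  then show ?thesis
    using i assms by (auto simp: radical_center_def dist_norm norm_minus_commute)
qed

section \<open>Mutually tangent spheres: Gram form, discriminant and center\<close>

locale tangent_spheres =
  fixes r :: "'v \<Rightarrow> real" and p :: "'v \<Rightarrow> real^3" and \<sigma> :: "'v set"
  assumes fin: "finite \<sigma>" and r_pos: "i \<in> \<sigma> \<Longrightarrow> 0 < r i"
    and inj: "inj_on p \<sigma>" and indep: "\<not> affine_dependent (p ` \<sigma>)"
    and dist_eq: "i \<in> \<sigma> \<Longrightarrow> j \<in> \<sigma> \<Longrightarrow> i \<noteq> j \<Longrightarrow> dist (p i) (p j) = r i + r j"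
begin

text \<open>The zero diagonal is written as a correction to \<open>(r i + r j)\<^sup>2\<close>, so
  that weighted sums of squared distances split into single sums.\<close>

lemma norm_diff_sq:
  assumes "i \<in> \<sigma>" "j \<in> \<sigma>"
  shows "(norm (p i - p j))\<^sup>2 = (r i + r j)\<^sup>2 - (if i = j then 4 * (r i)\<^sup>2 else 0)"
  using dist_eq[OF assms] by (simp add: dist_norm power2_eq_square)

lemma sum_norm_diff_sq:
  assumes "j \<in> \<sigma>"
  shows "(\<Sum>i\<in>\<sigma>. \<nu> i * (norm (p i - p j))\<^sup>2)
    = (\<Sum>i\<in>\<sigma>. \<nu> i * (r i)\<^sup>2) + 2 * r j * (\<Sum>i\<in>\<sigma>. \<nu> i * r i) + (r j)\<^sup>2 * sum \<nu> \<sigma> - 4 * \<nu> j * (r j)\<^sup>2"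
proof -
  have "(\<Sum>i\<in>\<sigma>. \<nu> i * (norm (p i - p j))\<^sup>2)
      = (\<Sum>i\<in>\<sigma>. \<nu> i * (r i)\<^sup>2 + 2 * r j * (\<nu> i * r i) + (r j)\<^sup>2 * \<nu> i
          - (if i = j then 4 * \<nu> j * (r j)\<^sup>2 else 0))"
    using assms by (intro sum.cong) (auto simp: norm_diff_sq power2_sum algebra_simps)
  also have "\<dots> = (\<Sum>i\<in>\<sigma>. \<nu> i * (r i)\<^sup>2) + 2 * r j * (\<Sum>i\<in>\<sigma>. \<nu> i * r i) + (r j)\<^sup>2 * sum \<nu> \<sigma> - 4 * \<nu> j * (r j)\<^sup>2"
    using assms fin by (simp add: sum.distrib sum_subtractf sum_distrib_left)
  finally show ?thesis .
qed

lemma double_sum_norm_diff_sq: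
  "(\<Sum>i\<in>\<sigma>. \<Sum>k\<in>\<sigma>. \<nu> i * \<nu> k * (norm (p i - p k))\<^sup>2)
    = 2 * sum \<nu> \<sigma> * (\<Sum>i\<in>\<sigma>. \<nu> i * (r i)\<^sup>2) + 2 * (\<Sum>i\<in>\<sigma>. \<nu> i * r i)\<^sup>2 - 4 * (\<Sum>i\<in>\<sigma>. (\<nu> i * r i)\<^sup>2)"
proof -
  have "(\<Sum>i\<in>\<sigma>. \<Sum>k\<in>\<sigma>. \<nu> i * \<nu> k * (norm (p i - p k))\<^sup>2)
      = (\<Sum>k\<in>\<sigma>. \<nu> k * (\<Sum>i\<in>\<sigma>. \<nu> i * (norm (p i - p k))\<^sup>2))"
    by (subst sum.swap) (simp add: sum_distrib_left ac_simps)
  also have "\<dots> = (\<Sum>k\<in>\<sigma>. (\<Sum>i\<in>\<sigma>. \<nu> i * (r i)\<^sup>2) * \<nu> k + 2 * (\<Sum>i\<in>\<sigma>. \<nu> i * r i) * (\<nu> k * r k)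
        + sum \<nu> \<sigma> * (\<nu> k * (r k)\<^sup>2) - 4 * (\<nu> k * r k)\<^sup>2)"
    by (intro sum.cong refl, subst sum_norm_diff_sq) (auto simp: power2_eq_square algebra_simps)
  also have "\<dots> = 2 * sum \<nu> \<sigma> * (\<Sum>i\<in>\<sigma>. \<nu> i * (r i)\<^sup>2) + 2 * (\<Sum>i\<in>\<sigma>. \<nu> i * r i)\<^sup>2 - 4 * (\<Sum>i\<in>\<sigma>. (\<nu> i * r i)\<^sup>2)"
    unfolding sum.distrib sum_subtractf sum_distrib_left[symmetric] by (simp add: power2_eq_square)
  finally show ?thesis .
qed

lemma affine_relation_trivial:
  assumes "sum \<nu> \<sigma> = 0" "(\<Sum>i\<in>\<sigma>. \<nu> i *\<^sub>R p i) = 0" "i \<in> \<sigma>"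
  shows "\<nu> i = 0"
proof (rule ccontr)
  assume "\<nu> i \<noteq> 0"
  define U where "U x = \<nu> (inv_into \<sigma> p x)" for x
  have U: "U (p i) = \<nu> i" if "i \<in> \<sigma>" for i
    using inj that by (simp add: U_def)
  have "sum U (p ` \<sigma>) = 0" "(\<Sum>x\<in>p ` \<sigma>. U x *\<^sub>R x) = 0"
    using assms(1,2) U by (simp_all add: sum.reindex[OF inj])
  then show False
    using indep fin \<open>i \<in> \<sigma>\<close> \<open>\<nu> i \<noteq> 0\<close> U by (auto simp: affine_dependent_explicit_finite)
qed

text \<open>For weights of sum 0, the difference of the two sides is the squared norm of the
  weighted sum of the vertices, which affine independence keeps nonzero.\<close>

lemma quadratic_form_pos:
  assumes "sum \<nu> \<sigma> = 0" "i \<in> \<sigma>" "\<nu> i \<noteq> 0"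
  shows "(\<Sum>i\<in>\<sigma>. \<nu> i * r i)\<^sup>2 < 2 * (\<Sum>i\<in>\<sigma>. (\<nu> i * r i)\<^sup>2)"
proof -
  have "(\<Sum>i\<in>\<sigma>. \<nu> i *\<^sub>R p i) \<noteq> 0"
    using affine_relation_trivial assms by blast
  then have "0 < (norm (\<Sum>i\<in>\<sigma>. \<nu> i *\<^sub>R (p i - 0)))\<^sup>2"
    by simp
  then show ?thesis
    unfolding norm_sum_weighted[OF fin] double_sum_norm_diff_sq assms(1) by simp
qed

lemma bend_sum_pos: "\<sigma> \<noteq> {} \<Longrightarrow> 0 < bend_sum r \<sigma>"
  unfolding bend_sum_def using fin r_pos by (intro sum_pos) auto

lemma sum_dev:
  assumes "3 \<le> card \<sigma>"
  shows "sum (dev r \<sigma>) \<sigma> = 2 * (bend_sum r \<sigma> / (real (card \<sigma>) - 2))"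
proof -
  have "sum (dev r \<sigma>) \<sigma> = real (card \<sigma>) * (bend_sum r \<sigma> / (real (card \<sigma>) - 2)) - bend_sum r \<sigma>"
    by (simp add: dev_def sum_subtractf bend_sum_def)
  also have "\<dots> = 2 * (bend_sum r \<sigma> / (real (card \<sigma>) - 2))"
    using assms by (simp add: field_simps)
  finally show ?thesis .
qed

lemma sum_dev_sq:
  assumes "3 \<le> card \<sigma>"
  shows "(\<Sum>i\<in>\<sigma>. (dev r \<sigma> i)\<^sup>2) = 2 * (bend_sum r \<sigma> / (real (card \<sigma>) - 2))\<^sup>2 - disc r \<sigma>"
proof -
  let ?k = "bend_sum r \<sigma> / (real (card \<sigma>) - 2)"
  have "(\<Sum>i\<in>\<sigma>. (dev r \<sigma> i)\<^sup>2) = (\<Sum>i\<in>\<sigma>. ?k * dev r \<sigma> i - dev r \<sigma> i / r i)"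
    unfolding power2_eq_square by (intro sum.cong refl, subst (2) dev_def) (simp add: algebra_simps)
  also have "\<dots> = ?k * sum (dev r \<sigma>) \<sigma> - disc r \<sigma>"
    by (simp only: sum_subtractf sum_distrib_left disc_def)
  finally show ?thesis
    using sum_dev[OF assms] by (simp add: power2_eq_square)
qed

text \<open>If the discriminant were at most 0, the test vector \<open>\<eta>\<close> would have
  negative sum, hence be nonzero, while the form of \<open>quadratic_form_pos\<close> takes at it a
  value at most 0.\<close>

lemma disc_pos:
  assumes "3 \<le> card \<sigma>"
  shows "0 < disc r \<sigma>"
proof (rule ccontr)
  assume "\<not> 0 < disc r \<sigma>"
  then have D: "disc r \<sigma> \<le> 0" by simp
  define K where "K = bend_sum r \<sigma>"
  define m where "m = real (card \<sigma>)"
  define D where "D = disc r \<sigma>"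
  have m: "3 \<le> m" using assms by (simp add: m_def)
  have K: "0 < K" unfolding K_def using assms by (intro bend_sum_pos) auto
  \<comment> \<open>\<open>\<eta>\<close> is, up to scaling, the projection of \<open>(1, \<dots>, 1)\<close> to the hyperplane \<open>sum \<nu> \<sigma> = 0\<close>,
    orthogonal for the Lorentzian form of \<open>quadratic_form_pos\<close>.\<close>
  define \<eta> where "\<eta> i = D - K * dev r \<sigma> i" for i
  define \<nu> where "\<nu> i = \<eta> i / r i" for i
  have \<nu>r: "\<nu> i * r i = \<eta> i" if "i \<in> \<sigma>" for i
    using r_pos[OF that] by (simp add: \<nu>_def)
  have "sum \<nu> \<sigma> = D * bend_sum r \<sigma> - K * disc r \<sigma>"
    by (simp add: \<nu>_def \<eta>_def bend_sum_def disc_def diff_divide_distrib sum_subtractf sum_distrib_left)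
  then have "sum \<nu> \<sigma> = 0" by (simp add: D_def K_def)
  have sum\<eta>: "sum \<eta> \<sigma> = m * D - K * (2 * (K / (m - 2)))"
    using sum_dev[OF assms] by (simp add: \<eta>_def sum_subtractf sum_distrib_left[symmetric] m_def K_def)
  have "(\<Sum>i\<in>\<sigma>. (\<eta> i)\<^sup>2) = (\<Sum>i\<in>\<sigma>. D\<^sup>2 - 2 * D * K * dev r \<sigma> i + K\<^sup>2 * (dev r \<sigma> i)\<^sup>2)"
    by (intro sum.cong) (auto simp: \<eta>_def power2_eq_square algebra_simps)
  also have "\<dots> = m * D\<^sup>2 - 2 * D * K * (2 * (K / (m - 2))) + K\<^sup>2 * (2 * (K / (m - 2))\<^sup>2 - D)"
    unfolding sum.distrib sum_subtractf sum_distrib_left[symmetric] sum_dev[OF assms] sum_dev_sq[OF assms]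
    by (simp add: m_def K_def D_def)
  finally have sum\<eta>2: "(\<Sum>i\<in>\<sigma>. (\<eta> i)\<^sup>2) = m * D\<^sup>2 - 2 * D * K * (2 * (K / (m - 2))) + K\<^sup>2 * (2 * (K / (m - 2))\<^sup>2 - D)" .
  have "0 < K * (2 * (K / (m - 2)))" using K m by simp
  moreover have "m * D \<le> 0" using D m by (simp add: D_def mult_nonneg_nonpos)
  ultimately have "sum \<eta> \<sigma> < 0" unfolding sum\<eta> by linarith
  then obtain i where i: "i \<in> \<sigma>" "\<eta> i \<noteq> 0"
    by (metis less_irrefl sum.neutral)
  then have "\<nu> i \<noteq> 0" using r_pos[OF i(1)] by (simp add: \<nu>_def)
  from quadratic_form_pos[OF \<open>sum \<nu> \<sigma> = 0\<close> i(1) this]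
  have "(sum \<eta> \<sigma>)\<^sup>2 < 2 * (\<Sum>i\<in>\<sigma>. (\<eta> i)\<^sup>2)"
    by (simp add: \<nu>r)
  moreover have "2 * (\<Sum>i\<in>\<sigma>. (\<eta> i)\<^sup>2) - (sum \<eta> \<sigma>)\<^sup>2 = D * (2 * K\<^sup>2 - m * (m - 2) * D)"
  proof -
    define k where "k = K / (m - 2)"
    have "K = k * (m - 2)" using m by (simp add: k_def)
    then show ?thesis
      unfolding sum\<eta> sum\<eta>2 k_def[symmetric] by algebra
  qed
  moreover have "D * (2 * K\<^sup>2 - m * (m - 2) * D) \<le> 0"
  proof -
    have "m * (m - 2) * D \<le> 0" using D m by (simp add: D_def mult_nonneg_nonpos)
    then have "0 \<le> 2 * K\<^sup>2 - m * (m - 2) * D" by (smt (verit) zero_le_power2)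
    then show ?thesis using D by (simp add: D_def mult_nonpos_nonneg)
  qed
  ultimately show False by linarith
qed

text \<open>The power with respect to sphere \<open>j\<close> depends on \<open>j\<close> only
  through \<open>r j * ((\<Sum>i\<in>\<sigma>. l i * r i) - 2 * (l j * r j))\<close>. Making this
  constant leads to the coordinates in \<open>center_weight\<close>.\<close>

lemma norm_combination_diff_sq:
  assumes "sum l \<sigma> = 1" "j \<in> \<sigma>"
  shows "(norm ((\<Sum>i\<in>\<sigma>. l i *\<^sub>R p i) - p j))\<^sup>2
    = (r j)\<^sup>2 + 2 * r j * ((\<Sum>i\<in>\<sigma>. l i * r i) - 2 * (l j * r j))
      - (\<Sum>i\<in>\<sigma>. l i * r i)\<^sup>2 + 2 * (\<Sum>i\<in>\<sigma>. (l i * r i)\<^sup>2)"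
proof -
  have "(\<Sum>i\<in>\<sigma>. l i *\<^sub>R p i) - p j = (\<Sum>i\<in>\<sigma>. l i *\<^sub>R (p i - p j))"
    using assms(1) by (simp add: scaleR_diff_right sum_subtractf flip: scaleR_left.sum)
  then have "(norm ((\<Sum>i\<in>\<sigma>. l i *\<^sub>R p i) - p j))\<^sup>2 = (norm (\<Sum>i\<in>\<sigma>. l i *\<^sub>R (p i - p j)))\<^sup>2"
    by simp
  also have "\<dots> = (r j)\<^sup>2 + 2 * r j * ((\<Sum>i\<in>\<sigma>. l i * r i) - 2 * (l j * r j))
      - (\<Sum>i\<in>\<sigma>. l i * r i)\<^sup>2 + 2 * (\<Sum>i\<in>\<sigma>. (l i * r i)\<^sup>2)"
    unfolding norm_sum_weighted[OF fin] double_sum_norm_diff_sq sum_norm_diff_sq[OF assms(2)] assms(1)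
    by (simp add: algebra_simps power2_eq_square add_divide_distrib diff_divide_distrib)
  finally show ?thesis .
qed

lemma combination_in_affine_hull:
  assumes "sum l \<sigma> = 1"
  shows "(\<Sum>i\<in>\<sigma>. l i *\<^sub>R p i) \<in> affine hull (p ` \<sigma>)"
proof -
  have "(\<Sum>x\<in>p ` \<sigma>. l (inv_into \<sigma> p x) *\<^sub>R x) = (\<Sum>i\<in>\<sigma>. l i *\<^sub>R p i)"
      "(\<Sum>x\<in>p ` \<sigma>. l (inv_into \<sigma> p x)) = sum l \<sigma>"
    by (simp_all add: sum.reindex[OF inj] inj)
  then show ?thesis
    using assms fin by (auto simp: affine_hull_finite)
qed

definition center_weight :: "'v \<Rightarrow> real" where
  "center_weight i = dev r \<sigma> i / (r i * disc r \<sigma>)"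

definition center :: "real^3" where
  "center = (\<Sum>i\<in>\<sigma>. center_weight i *\<^sub>R p i)"

lemma sum_center_weight:
  assumes "3 \<le> card \<sigma>"
  shows "sum center_weight \<sigma> = 1"
proof -
  have "sum center_weight \<sigma> = disc r \<sigma> / disc r \<sigma>"
    unfolding center_weight_def disc_def[of r \<sigma>] sum_divide_distrib
    by (simp add: disc_def)
  then show ?thesis using disc_pos[OF assms] by simp
qed

lemma radical_center_center:
  assumes "3 \<le> card \<sigma>"
  shows "radical_center r p \<sigma> center (2 / disc r \<sigma>)"
proof -
  define k where "k = bend_sum r \<sigma> / (real (card \<sigma>) - 2)"
  define D where "D = disc r \<sigma>"
  have D: "0 < D" using disc_pos[OF assms] by (simp add: D_def)
  have lr: "center_weight i * r i = dev r \<sigma> i / D" if "i \<in> \<sigma>" for i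
    using r_pos[OF that] by (simp add: center_weight_def D_def)
  have s1: "(\<Sum>i\<in>\<sigma>. center_weight i * r i) = 2 * k / D"
    using sum_dev[OF assms] by (simp add: lr k_def flip: sum_divide_distrib)
  have s2: "(\<Sum>i\<in>\<sigma>. (center_weight i * r i)\<^sup>2) = (2 * k\<^sup>2 - D) / D\<^sup>2"
    using sum_dev_sq[OF assms] by (simp add: lr k_def D_def power_divide flip: sum_divide_distrib)
  have "(norm (center - p j))\<^sup>2 = (r j)\<^sup>2 + 2 / D" if j: "j \<in> \<sigma>" for j
  proof -
    have "(norm (center - p j))\<^sup>2 = (r j)\<^sup>2 + 2 * r j * (2 * k / D - 2 * (dev r \<sigma> j / D))
        - (2 * k / D)\<^sup>2 + 2 * ((2 * k\<^sup>2 - D) / D\<^sup>2)"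
      unfolding center_def norm_combination_diff_sq[OF sum_center_weight[OF assms] j] s1 s2 lr[OF j] ..
    \<comment> \<open>By the choice of \<open>dev\<close> the factor \<open>r j\<close> cancels, so
      the power is the same for all spheres.\<close>
    also have "2 * k / D - 2 * (dev r \<sigma> j / D) = 2 / (r j * D)"
      using D r_pos[OF j] by (simp add: dev_def k_def[symmetric] field_simps)
    also have "(r j)\<^sup>2 + 2 * r j * (2 / (r j * D)) - (2 * k / D)\<^sup>2 + 2 * ((2 * k\<^sup>2 - D) / D\<^sup>2)
        = (r j)\<^sup>2 + 2 / D"
      using D r_pos[OF j] by (simp add: field_simps power2_eq_square)
    finally show ?thesis .
  qed
  then show ?thesis
    unfolding radical_center_def D_def center_def
    using combination_in_affine_hull[OF sum_center_weight[OF assms]] by simp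
qed

end

text \<open>The edge center is the tangency point of the two spheres, dividing the segment in the
  ratio \<open>r i : r j\<close>.\<close>

lemma edge_center_norms:
  assumes "0 < r i" "0 < r j" "dist (p i) (p j) = r i + r j" "d i j = r i"
  shows "edge_center d p i j \<in> affine hull {p i, p j}"
    and "norm (edge_center d p i j - p i) = r i" "norm (edge_center d p i j - p j) = r j"
proof -
  have pij: "norm (p j - p i) = r i + r j" "norm (p i - p j) = r i + r j"
    using assms(3) by (simp_all add: dist_norm norm_minus_commute)
  define s where "s = r i / (r i + r j)"
  have s: "0 \<le> s" "s \<le> 1" "s * (r i + r j) = r i" "(1 - s) * (r i + r j) = r j"
    using assms by (simp_all add: s_def field_simps)
  define c where "c = (1 - s) *\<^sub>R p i + s *\<^sub>R p j"
  have "c - p i = s *\<^sub>R (p j - p i)" "c - p j = (1 - s) *\<^sub>R (p i - p j)"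
    by (simp_all add: c_def algebra_simps)
  then have n: "norm (c - p i) = r i" "norm (c - p j) = r j"
    using s pij by simp_all
  have seg: "c \<in> closed_segment (p i) (p j)"
    using s by (auto simp: c_def in_segment)
  have "edge_center d p i j = c"
    unfolding edge_center_def
  proof (rule the_equality)
    show "c \<in> closed_segment (p i) (p j) \<and> dist (p i) c = d i j"
      using seg n assms by (simp add: dist_norm norm_minus_commute)
    fix c' assume c': "c' \<in> closed_segment (p i) (p j) \<and> dist (p i) c' = d i j"
    then obtain u where u: "0 \<le> u" "c' = (1 - u) *\<^sub>R p i + u *\<^sub>R p j"
      by (auto simp: in_segment)
    then have "c' - p i = u *\<^sub>R (p j - p i)"
      by (simp add: algebra_simps)
    then have "norm (c' - p i) = u * (r i + r j)"
      using u(1) pij by simp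
    then have "u * (r i + r j) = r i"
      using c' assms(4) by (simp add: dist_norm norm_minus_commute)
    then have "u * (r i + r j) = s * (r i + r j)"
      using s by simp
    then have "u = s" using assms by simp
    then show "c' = c" using u by (simp add: c_def)
  qed
  then show "edge_center d p i j \<in> affine hull {p i, p j}"
    and "norm (edge_center d p i j - p i) = r i" "norm (edge_center d p i j - p j) = r j"
    using n seg convex_hull_subset_affine_hull by (auto simp: segment_convex_hull)
qed

text \<open>For a triangle this is twice the second elementary symmetric polynomial of the bends,
  for a tetrahedron half of Descartes' discriminant.\<close>

lemma disc_eq:
  "disc r \<sigma> = (bend_sum r \<sigma>)\<^sup>2 / (real (card \<sigma>) - 2) - (\<Sum>i\<in>\<sigma>. (1 / r i)\<^sup>2)"
proof -
  have "disc r \<sigma> = (\<Sum>i\<in>\<sigma>. bend_sum r \<sigma> / (real (card \<sigma>) - 2) * (1 / r i) - (1 / r i)\<^sup>2)"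
    unfolding disc_def dev_def by (intro sum.cong) (auto simp: diff_divide_distrib power2_eq_square)
  also have "\<dots> = bend_sum r \<sigma> / (real (card \<sigma>) - 2) * bend_sum r \<sigma> - (\<Sum>i\<in>\<sigma>. (1 / r i)\<^sup>2)"
    unfolding sum_subtractf sum_distrib_left[symmetric] bend_sum_def ..
  finally show ?thesis by (simp add: power2_eq_square)
qed

text \<open>Makes \<open>2 / disc r \<tau> - 2 / disc r (\<tau> - {v})\<close> a square divided by
  the product of the discriminants, which yields the distance between the two centers.\<close>

lemma disc_facet:
  assumes "card \<tau> = 4" "v \<in> \<tau>"
  shows "disc r (\<tau> - {v}) = disc r \<tau> + 2 * (dev r \<tau> v)\<^sup>2"
proof -
  have fin: "finite \<tau>" using assms(1) by (metis card.infinite zero_neq_numeral)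
  have b: "bend_sum r (\<tau> - {v}) = bend_sum r \<tau> - 1 / r v"
    and s: "(\<Sum>i\<in>\<tau> - {v}. (1 / r i)\<^sup>2) = (\<Sum>i\<in>\<tau>. (1 / r i)\<^sup>2) - (1 / r v)\<^sup>2"
    using fin assms(2) by (simp_all only: bend_sum_def sum_diff1 if_True)
  have c: "card (\<tau> - {v}) = 3" using assms fin by simp
  have "(K - q)\<^sup>2 / (real 3 - 2) - (S - q\<^sup>2) = K\<^sup>2 / (real 4 - 2) - S + 2 * (K / (real 4 - 2) - q)\<^sup>2"
    for K q S :: real
    by (simp add: field_simps power2_eq_square)
  then show ?thesis
    unfolding disc_eq b s c assms(1) dev_def .
qed

section \<open>Centers and signed distances in a realization\<close>

context tangent_spheres
begin

lemma subset_tangent_spheres: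
  assumes "\<rho> \<subseteq> \<sigma>"
  shows "tangent_spheres r p \<rho>"
proof
  show "finite \<rho>" using assms fin finite_subset by blast
  show "inj_on p \<rho>" using assms inj inj_on_subset by blast
  show "\<not> affine_dependent (p ` \<rho>)"
    by (rule affine_independent_subset[OF indep image_mono[OF assms]])
  show "0 < r i" if "i \<in> \<rho>" for i
    using that assms r_pos by blast
  show "dist (p i) (p j) = r i + r j" if "i \<in> \<rho>" "j \<in> \<rho>" "i \<noteq> j" for i j
    using that assms dist_eq by blast
qed

lemma affine_hull_combination:
  assumes "x \<in> affine hull (p ` \<sigma>)"
  obtains l where "sum l \<sigma> = 1" "x = (\<Sum>i\<in>\<sigma>. l i *\<^sub>R p i)"
proof -
  obtain u where "sum u (p ` \<sigma>) = 1" "(\<Sum>v\<in>p ` \<sigma>. u v *\<^sub>R v) = x"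
    using assms fin by (auto simp: affine_hull_finite)
  then show thesis
    by (intro that[of "u \<circ> p"]) (simp_all add: sum.reindex[OF inj])
qed

text \<open>The barycentric coordinate at \<open>v\<close> vanishes on the hyperplane of the facet.
  Along the segment it runs affinely from \<open>l v\<close> to 1, so it has a zero iff
  \<open>l v\<close> is at most 0.\<close>

lemma segment_misses_facet_iff:
  assumes "sum l \<sigma> = 1" "v \<in> \<sigma>" and X: "X = (\<Sum>i\<in>\<sigma>. l i *\<^sub>R p i)"
  shows "closed_segment X (p v) \<inter> affine hull (p ` (\<sigma> - {v})) = {} \<longleftrightarrow> 0 < l v"
proof -
  interpret facet: tangent_spheres r p "\<sigma> - {v}"
    by (rule subset_tangent_spheres) auto
  define m where "m s i = (1 - s) * l i + (if i = v then s else 0)" for s i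
  have sum_m: "sum (m s) \<sigma> = 1" for s
    using assms(1,2) fin by (simp add: m_def sum.distrib flip: sum_distrib_left)
  have "(\<Sum>i\<in>\<sigma>. m s i *\<^sub>R p i) = (\<Sum>i\<in>\<sigma>. (1 - s) *\<^sub>R (l i *\<^sub>R p i) + (if i = v then s *\<^sub>R p v else 0))" for s
    by (intro sum.cong) (auto simp: m_def algebra_simps)
  then have comb_m: "(\<Sum>i\<in>\<sigma>. m s i *\<^sub>R p i) = (1 - s) *\<^sub>R X + s *\<^sub>R p v" for s
    using assms(2) fin by (simp add: X sum.distrib scaleR_sum_right)
  show ?thesis
  proof
    assume empty: "closed_segment X (p v) \<inter> affine hull (p ` (\<sigma> - {v})) = {}"
    show "0 < l v"
    proof (rule ccontr)
      assume "\<not> 0 < l v"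
      then have lv: "l v \<le> 0" by simp
      \<comment> \<open>The parameter at which the coordinate at \<open>v\<close> vanishes.\<close>
      define s where "s = - l v / (1 - l v)"
      have s: "0 \<le> s" "s \<le> 1" "m s v = 0"
        using lv by (simp_all add: s_def m_def field_simps)
      have "(1 - s) *\<^sub>R X + s *\<^sub>R p v = (\<Sum>i\<in>\<sigma> - {v}. m s i *\<^sub>R p i)" "sum (m s) (\<sigma> - {v}) = 1"
        using s(3) sum_m[of s] comb_m[of s] fin assms(2) by (simp_all add: sum_diff1)
      then have "(1 - s) *\<^sub>R X + s *\<^sub>R p v \<in> affine hull (p ` (\<sigma> - {v}))"
        using facet.combination_in_affine_hull by simp
      moreover have "(1 - s) *\<^sub>R X + s *\<^sub>R p v \<in> closed_segment X (p v)"
        using s by (auto simp: in_segment)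
      ultimately show False using empty by blast
    qed
  next
    assume lv: "0 < l v"
    have False if y: "y \<in> closed_segment X (p v)" "y \<in> affine hull (p ` (\<sigma> - {v}))" for y
    proof -
      obtain s where s: "0 \<le> s" "s \<le> 1" "y = (1 - s) *\<^sub>R X + s *\<^sub>R p v"
        using y(1) by (auto simp: in_segment)
      obtain n where n: "sum n (\<sigma> - {v}) = 1" "y = (\<Sum>i\<in>\<sigma> - {v}. n i *\<^sub>R p i)"
        using y(2) facet.affine_hull_combination by blast
      \<comment> \<open>The difference of two systems of barycentric coordinates of
        \<open>y\<close>; affine independence makes it vanish.\<close>
      define \<nu> where "\<nu> i = m s i - (if i = v then 0 else n i)" for i
      have "(\<Sum>i\<in>\<sigma> - {v}. if i = v then 0 else n i) = sum n (\<sigma> - {v})"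
        by (rule sum.cong) auto
      then have n': "(\<Sum>i\<in>\<sigma>. if i = v then 0 else n i) = 1"
        unfolding sum.remove[OF fin assms(2)] using n(1) by simp
      have "(\<Sum>i\<in>\<sigma> - {v}. (if i = v then 0 else n i) *\<^sub>R p i) = y"
        unfolding n(2) by (rule sum.cong) auto
      then have n'': "(\<Sum>i\<in>\<sigma>. (if i = v then 0 else n i) *\<^sub>R p i) = y"
        unfolding sum.remove[OF fin assms(2)] by simp
      have "sum \<nu> \<sigma> = 0"
        by (simp add: \<nu>_def sum_subtractf sum_m n')
      moreover have "(\<Sum>i\<in>\<sigma>. \<nu> i *\<^sub>R p i) = 0"
        by (simp add: \<nu>_def scaleR_diff_left sum_subtractf comb_m n'' s(3))
      ultimately have "\<nu> v = 0"
        using affine_relation_trivial assms(2) by blast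
      then have "(1 - s) * l v + s = 0" by (simp add: \<nu>_def m_def)
      moreover have "0 \<le> (1 - s) * l v" using s lv by simp
      ultimately have "s = 0" "(1 - s) * l v = 0" using s by linarith+
      then show False using lv by simp
    qed
    then show "closed_segment X (p v) \<inter> affine hull (p ` (\<sigma> - {v})) = {}"
      by blast
  qed
qed

lemma radical_center_edge:
  assumes "i \<in> \<sigma>" "j \<in> \<sigma>" "i \<noteq> j" "d i j = r i"
  shows "radical_center r p {i, j} (edge_center d p i j) 0"
  using edge_center_norms[of r i j p d] assms r_pos dist_eq by (auto simp: radical_center_def)

text \<open>The perpendicular hyperplane at an edge center is the radical hyperplane of the two
  spheres, as the tangency point has power 0 for both. Two such centers differ by a vector both
  along the span and orthogonal to it.\<close>

lemma simplex_center_eq: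
  assumes d: "\<And>i j. i \<in> \<sigma> \<Longrightarrow> j \<in> \<sigma> \<Longrightarrow> i \<noteq> j \<Longrightarrow> d i j = r i"
    and X: "radical_center r p \<sigma> X t"
  shows "simplex_center d p \<sigma> = X"
proof -
  have plane: "(c - edge_center d p i j) \<bullet> (p j - p i) = 0 \<longleftrightarrow>
      (norm (c - p i))\<^sup>2 - (r i)\<^sup>2 = (norm (c - p j))\<^sup>2 - (r j)\<^sup>2"
    if "i \<in> \<sigma>" "j \<in> \<sigma>" "i \<noteq> j" for c i j
  proof -
    have "2 * ((c - edge_center d p i j) \<bullet> (p j - p i))
        = (norm (c - p i))\<^sup>2 - (norm (c - p j))\<^sup>2 - ((r i)\<^sup>2 - (r j)\<^sup>2)"
      unfolding inner_eq_norm_diff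
        edge_center_norms(2,3)[of r i j p d, OF r_pos[OF that(1)] r_pos[OF that(2)] dist_eq[OF that] d[OF that]]
      by linarith
    then show ?thesis by linarith
  qed
  show ?thesis
    unfolding simplex_center_def
  proof (rule the_equality)
    show "X \<in> affine hull (p ` \<sigma>) \<and>
        (\<forall>i\<in>\<sigma>. \<forall>j\<in>\<sigma>. i \<noteq> j \<longrightarrow> (X - edge_center d p i j) \<bullet> (p j - p i) = 0)"
      using X by (simp add: plane radical_center_def)
    fix c assume c: "c \<in> affine hull (p ` \<sigma>) \<and>
        (\<forall>i\<in>\<sigma>. \<forall>j\<in>\<sigma>. i \<noteq> j \<longrightarrow> (c - edge_center d p i j) \<bullet> (p j - p i) = 0)"
    have perp: "(c - X) \<bullet> (p i - p j) = 0" if "i \<in> \<sigma>" "j \<in> \<sigma>" for i j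
    proof (cases "i = j")
      case False
      then have "(norm (c - p i))\<^sup>2 - (r i)\<^sup>2 = (norm (c - p j))\<^sup>2 - (r j)\<^sup>2"
        using c that plane by blast
      then show ?thesis
        using inner_eq_norm_diff[of c X "p i" "p j"] X that by (simp add: radical_center_def)
    qed simp
    then have "(c - X) \<bullet> (c - X) = 0"
      using inner_zero_affine_hull[of \<sigma> "c - X" p c X, OF perp] c X by (simp add: radical_center_def)
    then show "c = X" by simp
  qed
qed

text \<open>The distance is a difference of powers. The side is read off from the barycentric
  coordinate of the center at \<open>v\<close>, a positive multiple of
  \<open>dev r \<sigma> v\<close>.\<close>

lemma signed_dist_realized:
  assumes d: "\<And>i j. i \<in> \<sigma> \<Longrightarrow> j \<in> \<sigma> \<Longrightarrow> i \<noteq> j \<Longrightarrow> d i j = r i"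
    and "3 \<le> card \<sigma>" "v \<in> \<sigma>" and X: "radical_center r p (\<sigma> - {v}) X t"
  shows "(if same_side d p (\<sigma> - {v}) \<sigma> then 1 else - 1)
      * dist (simplex_center d p (\<sigma> - {v})) (simplex_center d p \<sigma>)
    = (if 0 < dev r \<sigma> v then 1 else - 1) * sqrt (2 / disc r \<sigma> - t)"
proof -
  interpret facet: tangent_spheres r p "\<sigma> - {v}"
    by (rule subset_tangent_spheres) auto
  have c: "radical_center r p \<sigma> center (2 / disc r \<sigma>)"
    using radical_center_center assms(2) by blast
  have sc: "simplex_center d p \<sigma> = center" "simplex_center d p (\<sigma> - {v}) = X"
    using simplex_center_eq[OF d c] facet.simplex_center_eq[OF _ X, of d] d by auto
  have "\<sigma> - (\<sigma> - {v}) = {v}" using assms(3) by auto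
  then have "same_side d p (\<sigma> - {v}) \<sigma> \<longleftrightarrow> 0 < center_weight v"
    unfolding same_side_def sc
    using segment_misses_facet_iff[OF sum_center_weight[OF assms(2)] assms(3) center_def] by simp
  also have "\<dots> \<longleftrightarrow> 0 < dev r \<sigma> v"
    using mult_pos_pos[OF r_pos[OF assms(3)] disc_pos[OF assms(2)]]
    by (simp add: center_weight_def zero_less_divide_iff del: mult_less_0_iff zero_less_mult_iff)
  finally have side: "same_side d p (\<sigma> - {v}) \<sigma> \<longleftrightarrow> 0 < dev r \<sigma> v" .
  have "(dist X center)\<^sup>2 = 2 / disc r \<sigma> - t"
    using radical_center_dist[OF _ X c] by auto
  then have "dist X center = sqrt (2 / disc r \<sigma> - t)"
    by (metis real_sqrt_unique zero_le_dist)
  with side show ?thesis by (simp add: sc)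
qed

end

lemma euclidean_simplex_tangent_spheres:
  assumes "euclidean_simplex d \<sigma> p" "finite \<sigma>" "\<And>i. i \<in> \<sigma> \<Longrightarrow> 0 < r i"
    and "\<And>i j. i \<in> \<sigma> \<Longrightarrow> j \<in> \<sigma> \<Longrightarrow> i \<noteq> j \<Longrightarrow> d i j = r i"
  shows "tangent_spheres r p \<sigma>"
  using assms by unfold_locales (auto simp: euclidean_simplex_def edge_length_def)

text \<open>The sign is always positive here, since \<open>dev\<close> at a vertex of a triangle is
  the sum of the other two bends. The value is the inradius.\<close>

lemma signed_dist_triangle:
  assumes ex: "\<exists>p. euclidean_simplex d \<sigma> p" and r: "\<And>i. i \<in> \<sigma> \<Longrightarrow> 0 < r i"
    and d: "\<And>i j. i \<in> \<sigma> \<Longrightarrow> j \<in> \<sigma> \<Longrightarrow> i \<noteq> j \<Longrightarrow> d i j = r i"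
    and "card \<sigma> = 3" "{i, j} \<subseteq> \<sigma>" "i \<noteq> j"
  shows "signed_dist d {i, j} \<sigma> = sqrt (2 / disc r \<sigma>)"
proof -
  define p where "p = (SOME p. euclidean_simplex d \<sigma> p)"
  have fin: "finite \<sigma>" using assms(4) by (metis card.infinite zero_neq_numeral)
  have "euclidean_simplex d \<sigma> p" unfolding p_def by (rule someI_ex[OF ex])
  then interpret tangent_spheres r p \<sigma>
    using fin r d by (rule euclidean_simplex_tangent_spheres)
  have "card (\<sigma> - {i, j}) = 1" using assms fin by (simp add: card_Diff_subset)
  then obtain v where "\<sigma> - {i, j} = {v}" by (metis card_1_singletonE)
  then have v: "v \<in> \<sigma>" "\<sigma> - {v} = {i, j}" using assms by auto
  have "0 < bend_sum r {i, j}"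
    unfolding bend_sum_def using r assms by (simp add: add_pos_pos)
  also have "\<dots> = dev r \<sigma> v"
    using fin v assms(4) by (simp add: dev_def bend_sum_def sum_diff1 flip: v(2))
  finally show ?thesis
    using signed_dist_realized[OF d _ v(1), where X = "edge_center d p i j" and t = 0] radical_center_edge[of i j d] d assms
    unfolding v(2) signed_dist_def p_def[symmetric] by (simp add: Let_def)
qed

text \<open>The root of the power difference contains the absolute value of
  \<open>dev r \<tau> v\<close>, and the side supplies its sign.\<close>

lemma signed_dist_tetrahedron:
  assumes ex: "\<exists>p. euclidean_simplex d \<tau> p" and r: "\<And>i. i \<in> \<tau> \<Longrightarrow> 0 < r i"
    and d: "\<And>i j. i \<in> \<tau> \<Longrightarrow> j \<in> \<tau> \<Longrightarrow> i \<noteq> j \<Longrightarrow> d i j = r i"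
    and "card \<tau> = 4" "v \<in> \<tau>"
  shows "0 < disc r \<tau>"
    and "signed_dist d (\<tau> - {v}) \<tau> = sqrt 2 * sqrt 2 * dev r \<tau> v / (sqrt (disc r \<tau>) * sqrt (disc r (\<tau> - {v})))"
proof -
  define p where "p = (SOME p. euclidean_simplex d \<tau> p)"
  have fin: "finite \<tau>" using assms(4) by (metis card.infinite zero_neq_numeral)
  have "euclidean_simplex d \<tau> p" unfolding p_def by (rule someI_ex[OF ex])
  then interpret tangent_spheres r p \<tau>
    using fin r d by (rule euclidean_simplex_tangent_spheres)
  interpret facet: tangent_spheres r p "\<tau> - {v}"
    by (rule subset_tangent_spheres) auto
  have c: "card (\<tau> - {v}) = 3" using assms fin by simp
  show D: "0 < disc r \<tau>" using disc_pos assms(4) by simp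
  have E: "0 < disc r (\<tau> - {v})" using facet.disc_pos c by simp
  define y where "y = dev r \<tau> v"
  have "2 / disc r \<tau> - 2 / disc r (\<tau> - {v}) = (2 * y)\<^sup>2 / (disc r \<tau> * disc r (\<tau> - {v}))"
    using D E disc_facet[OF assms(4,5), of r, folded y_def] by (simp add: field_simps power2_eq_square)
  then have "sqrt (2 / disc r \<tau> - 2 / disc r (\<tau> - {v})) = 2 * \<bar>y\<bar> / (sqrt (disc r \<tau>) * sqrt (disc r (\<tau> - {v})))"
    by (simp add: real_sqrt_divide real_sqrt_mult abs_mult)
  then show "signed_dist d (\<tau> - {v}) \<tau> = sqrt 2 * sqrt 2 * dev r \<tau> v / (sqrt (disc r \<tau>) * sqrt (disc r (\<tau> - {v})))"
    using signed_dist_realized[OF d _ assms(5) facet.radical_center_center] c assms(4)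
    unfolding signed_dist_def p_def[symmetric] y_def[symmetric] by (auto simp: Let_def)
qed

section \<open>Triangulated connected 3-manifolds\<close>

lemma hull_axis_support:
  assumes "z \<in> convex hull ((\<lambda>v. axis v (1::real)) ` \<sigma>)" "v \<notin> \<sigma>"
  shows "z $ v = 0"
proof -
  have "convex {z::real^'a. z $ v = 0}"
    by (auto simp: convex_def)
  then have "convex hull ((\<lambda>v. axis v (1::real)) ` \<sigma>) \<subseteq> {z. z $ v = 0}"
    using assms(2) by (intro hull_minimal) (auto simp: axis_def)
  then show ?thesis
    using assms(1) by blast
qed

lemma constant_if_constant_on_edges:
  fixes x :: "'v::finite \<Rightarrow> real"
  assumes T: "vertex_complex T" and conn: "connected (polyhedron_of T)"
    and edges: "\<And>i j. {i, j} \<in> simplices T 1 \<Longrightarrow> x i = x j"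
  shows "x i = x j"
proof -
  \<comment> \<open>The piecewise linear extension of \<open>x\<close> takes finitely many values on a connected space.\<close>
  define f :: "real^'v \<Rightarrow> real" where "f z = z \<bullet> (\<chi> v. x v)" for z
  have f_axis: "f (axis v 1) = x v" for v
    by (simp add: f_def inner_axis')
  have on_simplex: "f z = x v" if "\<sigma> \<in> T" "v \<in> \<sigma>" "z \<in> convex hull ((\<lambda>v. axis v 1) ` \<sigma>)" for z :: "real^'v" and \<sigma> v
  proof -
    have "x w = x v" if "w \<in> \<sigma>" for w
    proof (cases "w = v")
      case False
      then have "{w, v} \<in> T"
        using T \<open>\<sigma> \<in> T\<close> \<open>v \<in> \<sigma>\<close> that unfolding vertex_complex_def by (metis empty_subsetI insert_not_empty insert_subset)
      with False show ?thesis
        by (intro edges) (simp add: simplices_def)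
    qed simp
    moreover have "convex {z. f z = x v}"
      unfolding f_def using convex_hyperplane[of "\<chi> v. x v" "x v"] by (simp add: inner_commute)
    ultimately have "convex hull ((\<lambda>v. axis v 1) ` \<sigma>) \<subseteq> {z. f z = x v}"
      by (intro hull_minimal) (auto simp: f_axis)
    with that show ?thesis by blast
  qed
  have "f ` polyhedron_of T \<subseteq> range x"
    unfolding polyhedron_of_def
  proof (clarsimp)
    fix z :: "real^'v" and \<sigma> assume *: "\<sigma> \<in> T" "z \<in> convex hull ((\<lambda>v. axis v 1) ` \<sigma>)"
    then obtain v where "v \<in> \<sigma>"
      using T unfolding vertex_complex_def by (metis all_not_in_conv)
    with * on_simplex show "f z \<in> range x" by blast
  qed
  then have "finite (f ` polyhedron_of T)"
    by (rule finite_subset) simp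
  moreover have "continuous_on (polyhedron_of T) f"
    unfolding f_def by (intro continuous_intros)
  then have "connected (f ` polyhedron_of T)"
    using conn connected_continuous_image by blast
  moreover have in_P: "axis v 1 \<in> polyhedron_of T" for v
    using T unfolding vertex_complex_def polyhedron_of_def by (intro UN_I[of "{v}"]) auto
  ultimately obtain c where "f ` polyhedron_of T = {c}"
    using connected_finite_iff_sing[of "f ` polyhedron_of T"] by blast
  then have "f (axis v 1) = c" for v
    using in_P by blast
  then show ?thesis
    unfolding f_axis by metis
qed

text \<open>Passes from sequences supported on the first three indices to \<open>real^3\<close>,
  where invariance of dimension is applied.\<close>

lemma Euclidean_space_3_chart:
  assumes "y \<in> topspace (Euclidean_space 3)"
  obtains \<iota> :: "real^3 \<Rightarrow> nat \<Rightarrow> real" where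
    "continuous_map euclidean (Euclidean_space 3) \<iota>" "inj \<iota>" "y \<in> range \<iota>"
proof -
  obtain e where e: "bij_betw e {0..<3::nat} (UNIV::3 set)"
    using ex_bij_betw_nat_finite[of "UNIV::3 set"] by auto
  define \<iota> :: "real^3 \<Rightarrow> nat \<Rightarrow> real" where "\<iota> x = (\<lambda>i. if i < 3 then x $ e i else 0)" for x
  show thesis
  proof
    show "continuous_map euclidean (Euclidean_space 3) \<iota>"
      unfolding \<iota>_def continuous_map_componentwise_Euclidean_space
      by (simp add: continuous_on_component)
    show "inj \<iota>"
    proof (rule injI)
      fix x x' assume eq: "\<iota> x = \<iota> x'"
      have "x $ k = x' $ k" for k
      proof -
        obtain i where "i < 3" "k = e i"
          using e by (metis UNIV_I atLeastLessThan_iff bij_betw_imp_surj_on imageE)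
        then show ?thesis
          using fun_cong[OF eq, of i] by (simp add: \<iota>_def)
      qed
      then show "x = x'" by (simp add: vec_eq_iff)
    qed
    have "\<iota> (\<chi> k. y (inv_into {0..<3} e k)) = y"
      using assms e by (auto simp: \<iota>_def topspace_Euclidean_space bij_betw_def fun_eq_iff)
    then show "y \<in> range \<iota>" by (metis rangeI)
  qed
qed

lemma manifold_simplex_in_3_simplex:
  fixes T :: "'v::finite set set"
  assumes man: "topological_manifold 3 M" and tri: "triangulates T M"
    and dim: "\<And>\<tau>. \<tau> \<in> T \<Longrightarrow> card \<tau> \<le> 4" and "\<sigma> \<in> T"
  shows "\<exists>\<tau> \<in> simplices T 3. \<sigma> \<subseteq> \<tau>"
proof -
  let ?P = "polyhedron_of T"
  have T: "vertex_complex T" using tri by (simp add: triangulates_def)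
  obtain \<tau> where \<tau>: "\<tau> \<in> T" "\<sigma> \<subseteq> \<tau>" and max: "\<And>\<tau>'. \<tau>' \<in> T \<Longrightarrow> \<tau> \<subseteq> \<tau>' \<Longrightarrow> \<tau> = \<tau>'"
    using finite_has_maximal2[of T \<sigma>] \<open>\<sigma> \<in> T\<close> by auto
  have "\<tau> \<noteq> {}" using T \<tau> by (auto simp: vertex_complex_def)
  \<comment> \<open>By maximality, the open star of \<open>\<tau>\<close> lies in the affine hull of \<open>\<tau>\<close>, and it is locally
    homeomorphic to an open set of \<open>real^3\<close>.\<close>
  define H :: "(real^'v) set" where "H = affine hull ((\<lambda>v. axis v 1) ` \<tau>)"
  define W where "W = {z \<in> ?P. \<forall>v\<in>\<tau>. 0 < z $ v}"
  have W_H: "W \<subseteq> H"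
  proof
    fix z assume "z \<in> W"
    then obtain \<tau>' where \<tau>': "\<tau>' \<in> T" "z \<in> convex hull ((\<lambda>v. axis v 1) ` \<tau>')" and pos: "\<forall>v\<in>\<tau>. 0 < z $ v"
      by (auto simp: W_def polyhedron_of_def)
    have "\<tau> \<subseteq> \<tau>'"
      using hull_axis_support[OF \<tau>'(2)] pos by (metis less_irrefl subsetI)
    then have "\<tau>' = \<tau>" using max \<tau>'(1) by blast
    then show "z \<in> H"
      using \<tau>'(2) convex_hull_subset_affine_hull unfolding H_def by blast
  qed
  \<comment> \<open>The barycenter of \<open>\<tau>\<close> shows that the star is nonempty; the
    chart is taken at its image.\<close>
  define b :: "real^'v" where "b = (\<Sum>v\<in>\<tau>. (1 / card \<tau>) *\<^sub>R axis v 1)"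
  have b_nth: "b $ v = (if v \<in> \<tau> then 1 / card \<tau> else 0)" for v
    by (simp add: b_def axis_def if_distrib sum.delta cong: if_cong)
  have "b \<in> convex hull ((\<lambda>v. axis v 1) ` \<tau>)"
    unfolding b_def using \<open>\<tau> \<noteq> {}\<close>
    by (intro convex_sum) (auto intro: hull_inc)
  then have "b \<in> ?P" using \<tau> by (auto simp: polyhedron_of_def)
  then have "b \<in> W"
    using \<open>\<tau> \<noteq> {}\<close> by (auto simp: W_def b_nth card_gt_0_iff)
  have "open {z. \<forall>v\<in>\<tau>. 0 < (z::real^'v) $ v}"
    unfolding Collect_ball_eq by (intro open_INT) (auto intro: open_halfspace_component_gt_cart)
  then have W_open: "openin (top_of_set ?P) W"
    unfolding W_def Collect_conj_eq Collect_mem_eq by (rule openin_open_Int)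
  obtain f g where fg: "homeomorphic_maps (top_of_set ?P) M f g"
    using tri by (auto simp: triangulates_def homeomorphic_space_def)
  then have f: "homeomorphic_map (top_of_set ?P) M f"
    by (metis homeomorphic_maps_map)
  have fW: "openin M (f ` W)"
    using homeomorphic_map_openness_eq[OF f] W_open by blast
  have "f b \<in> topspace M"
    using fW \<open>b \<in> W\<close> openin_subset by blast
  then obtain U V where U: "openin M U" "f b \<in> U" and V: "openin (Euclidean_space 3) V"
    and "subtopology M U homeomorphic_space subtopology (Euclidean_space 3) V"
    using man unfolding topological_manifold_def by blast
  then obtain \<phi> \<psi> where \<phi>\<psi>: "homeomorphic_maps (subtopology M U) (subtopology (Euclidean_space 3) V) \<phi> \<psi>"
    by (auto simp: homeomorphic_space_def)
  have Usub: "U \<subseteq> topspace M" and Vsub: "V \<subseteq> topspace (Euclidean_space 3)"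
    using U V openin_subset by blast+
  have \<psi>: "continuous_map (subtopology (Euclidean_space 3) V) (subtopology M U) \<psi>"
    and \<phi>: "continuous_map (subtopology M U) (subtopology (Euclidean_space 3) V) \<phi>"
    and \<psi>\<phi>: "\<And>x. x \<in> U \<Longrightarrow> \<psi> (\<phi> x) = x" and \<phi>\<psi>_id: "\<And>y. y \<in> V \<Longrightarrow> \<phi> (\<psi> y) = y"
    using \<phi>\<psi> Usub Vsub unfolding homeomorphic_maps_def by (auto simp: inf.absorb2)
  have g: "continuous_map M (top_of_set ?P) g" and gf: "\<And>z. z \<in> ?P \<Longrightarrow> g (f z) = z"
    and fg_id: "\<And>m. m \<in> topspace M \<Longrightarrow> f (g m) = m"
    using fg unfolding homeomorphic_maps_def by auto
  \<comment> \<open>The part of the star seen by the chart, as an open set of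
    \<open>Euclidean_space 3\<close>.\<close>
  define O' where "O' = {y \<in> topspace (subtopology (Euclidean_space 3) V). \<psi> y \<in> f ` W \<inter> U}"
  have "openin (subtopology M U) (f ` W \<inter> U)"
    using fW by (simp add: openin_subtopology_Int)
  then have "openin (subtopology (Euclidean_space 3) V) O'"
    unfolding O'_def using \<psi> openin_continuous_map_preimage by blast
  then have O': "openin (Euclidean_space 3) O'"
    using V by (metis openin_trans_full)
  have "\<phi> (f b) \<in> O'"
    using U \<open>b \<in> W\<close> \<psi>\<phi> \<phi> Usub unfolding O'_def continuous_map_def
    by (auto simp: inf.absorb2 Pi_iff)
  with O' obtain \<iota> :: "real^3 \<Rightarrow> nat \<Rightarrow> real" where
    \<iota>: "continuous_map euclidean (Euclidean_space 3) \<iota>" "inj \<iota>" "\<phi> (f b) \<in> range \<iota>"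
    using Euclidean_space_3_chart openin_subset by blast
  define S where "S = {x. \<iota> x \<in> O'}"
  have "S \<noteq> {}" using \<iota>(3) \<open>\<phi> (f b) \<in> O'\<close> by (auto simp: S_def)
  have "open S"
    using openin_continuous_map_preimage[OF \<iota>(1) O'] by (simp add: S_def)
  \<comment> \<open>A continuous injection of the open set \<open>S\<close> into the affine hull
    \<open>H\<close>.\<close>
  define F where "F = g \<circ> \<psi> \<circ> \<iota>"
  have SV: "\<iota> x \<in> V \<and> \<psi> (\<iota> x) \<in> f ` W \<inter> U" if "x \<in> S" for x
    using that by (auto simp: S_def O'_def)
  have c1: "continuous_map (top_of_set S) (subtopology (Euclidean_space 3) V) \<iota>"
    using \<iota>(1) SV by (auto simp: continuous_map_in_subtopology continuous_map_from_subtopology)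
  have c2: "continuous_map (subtopology M U) (top_of_set ?P) g"
    using g by (rule continuous_map_from_subtopology)
  have "continuous_map (top_of_set S) (top_of_set ?P) F"
    unfolding F_def by (metis c1 c2 \<psi> continuous_map_compose comp_assoc)
  then have "continuous_on S F" by simp
  moreover have "F \<in> S \<rightarrow> H"
  proof
    fix x assume "x \<in> S"
    then obtain w where "w \<in> W" "\<psi> (\<iota> x) = f w" using SV by blast
    then show "F x \<in> H"
      using W_H gf by (auto simp: F_def W_def)
  qed
  moreover have "inj_on F S"
  proof (rule inj_onI)
    fix x x' assume x: "x \<in> S" "x' \<in> S" "F x = F x'"
    then have "f (g (\<psi> (\<iota> x))) = f (g (\<psi> (\<iota> x')))" by (simp add: F_def)
    then have "\<psi> (\<iota> x) = \<psi> (\<iota> x')"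
      using SV x Usub fg_id by (metis IntD2 subsetD)
    then have "\<iota> x = \<iota> x'" using SV x \<phi>\<psi>_id by metis
    then show "x = x'" using \<iota>(2) by (simp add: inj_eq)
  qed
  moreover have "openin (top_of_set UNIV) S" using \<open>open S\<close> by simp
  \<comment> \<open>Invariance of dimension gives \<open>H\<close> dimension at least 3, so
    \<open>\<tau>\<close> has at least four vertices.\<close>
  ultimately have "aff_dim (UNIV :: (real^3) set) \<le> aff_dim H"
    using \<open>S \<noteq> {}\<close> by (intro invariance_of_dimension_affine_sets[of UNIV S H F]) (auto simp: H_def)
  also have "\<dots> \<le> int (card ((\<lambda>v. axis v (1::real)) ` \<tau>)) - 1"
    unfolding H_def aff_dim_affine_hull by (rule aff_dim_le_card) simp
  also have "\<dots> \<le> int (card \<tau>) - 1"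
    using card_image_le[of \<tau> "\<lambda>v. axis v (1::real)"] by simp
  finally have "4 \<le> card \<tau>" by (simp add: aff_dim_UNIV)
  with dim[OF \<tau>(1)] have "\<tau> \<in> simplices T 3"
    using \<tau>(1) by (simp add: simplices_def)
  with \<tau>(2) show ?thesis by blast
qed

section \<open>The Laplacian as a sum over tetrahedra\<close>

text \<open>The sum of the signed distance products at an edge without the factor common to the
  tetrahedron; a face is indexed by its opposite vertex.\<close>

definition facet_sum :: "('v \<Rightarrow> real) \<Rightarrow> 'v set \<Rightarrow> 'v \<Rightarrow> 'v \<Rightarrow> real" where
  "facet_sum r \<tau> i j = (\<Sum>v\<in>\<tau> - {i, j}. dev r \<tau> v / disc r (\<tau> - {v}))"

text \<open>The sum runs over ordered pairs, so each edge counts twice.\<close>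

definition energy :: "('v \<Rightarrow> real) \<Rightarrow> 'v set \<Rightarrow> ('v \<Rightarrow> real) \<Rightarrow> real" where
  "energy r \<tau> x = (\<Sum>i\<in>\<tau>. \<Sum>j\<in>\<tau> - {i}. facet_sum r \<tau> i j / (r i + r j) * (x i - x j)\<^sup>2)"

text \<open>The quarter comes from the denominator 2 in \<open>dev\<close> of a tetrahedron and the
  factor 2 between \<open>disc\<close> of a triangle and \<open>pairprod\<close>.\<close>

lemma facet_sum_eq_edgewt:
  assumes dist: "distinct [a, b, c, t]" and pos: "0 < r a" "0 < r b" "0 < r c" "0 < r t"
  shows "facet_sum r {a, b, c, t} a b / (r a + r b)
    = edgewt (1 / r a) (1 / r b) (1 / r c) (1 / r t) / 4"
proof -
  have card: "card {a, b, c, t} = 4" using dist by simp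
  have sets: "{a, b, c, t} - {a, b} = {c, t}" "{a, b, c, t} - {c} = {a, b, t}" "{a, b, c, t} - {t} = {a, b, c}"
    using dist by auto
  have disc3: "disc r {x, y, z} = 2 * pairprod (1 / r x) (1 / r y) (1 / r z)"
    if "distinct [x, y, z]" for x y z
    using that by (simp add: disc_eq bend_sum_def pairprod_def power2_eq_square algebra_simps)
  have dist': "distinct [a, b, t]" "distinct [a, b, c]" using dist by auto
  have dev4: "dev r {a, b, c, t} c = (1 / r a + 1 / r b + 1 / r t - 1 / r c) / 2"
      "dev r {a, b, c, t} t = (1 / r a + 1 / r b + 1 / r c - 1 / r t) / 2"
    unfolding dev_def card bend_sum_def using dist
    by (simp_all add: add_divide_distrib diff_divide_distrib)
  have h: "1 / r a * (1 / r b) / (1 / r a + 1 / r b) = 1 / (r a + r b)"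
    using pos by (simp add: field_simps)
  have quarter: "F / s = 1 / s * X / 4" if "F = X / 4" for F s X :: real
    unfolding that by simp
  have half: "A / 2 / (2 * B) + A' / 2 / (2 * B') = (A / B + A' / B') / 4" for A B A' B' :: real
    by (simp add: add_divide_distrib)
  have "facet_sum r {a, b, c, t} a b = dev r {a, b, c, t} c / disc r {a, b, t} + dev r {a, b, c, t} t / disc r {a, b, c}"
    unfolding facet_sum_def sets(1) using dist by (simp add: sets)
  also have "\<dots> = ((1 / r a + 1 / r b + 1 / r t - 1 / r c) / pairprod (1 / r a) (1 / r b) (1 / r t)
      + (1 / r a + 1 / r b + 1 / r c - 1 / r t) / pairprod (1 / r a) (1 / r b) (1 / r c)) / 4"
    unfolding dev4 disc3[OF dist'(1)] disc3[OF dist'(2)] half ..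
  finally show ?thesis
    unfolding edgewt_def h by (rule quarter)
qed

lemma energy_definite:
  assumes "card \<tau> = 4" and r: "\<And>i. i \<in> \<tau> \<Longrightarrow> 0 < r i" and disc: "0 < disc r \<tau>"
  shows "0 \<le> energy r \<tau> x" and "energy r \<tau> x \<le> 0 \<Longrightarrow> i \<in> \<tau> \<Longrightarrow> j \<in> \<tau> \<Longrightarrow> x i = x j"
proof -
  have "finite \<tau>" using assms(1) by (metis card.infinite zero_neq_numeral)
  then obtain xs where xs: "set xs = \<tau>" "distinct xs"
    using finite_distinct_list by blast
  then have "length xs = 4" using assms(1) distinct_card by metis
  then obtain a b c t where "xs = [a, b, c, t]"
    by (auto simp: length_Suc_conv numeral_eq_Suc)
  with xs have \<tau>: "\<tau> = {a, b, c, t}" and dist: "distinct [a, b, c, t]" by auto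
  have pos: "0 < r a" "0 < r b" "0 < r c" "0 < r t" using r \<tau> by auto
  \<comment> \<open>Nondegeneracy enters here: Descartes' discriminant is twice
    \<open>disc\<close>.\<close>
  have "soddy (1 / r a) (1 / r b) (1 / r c) (1 / r t) = 2 * disc r \<tau>"
    using dist by (simp add: disc_eq bend_sum_def soddy_def \<tau> power2_eq_square algebra_simps)
  then have s: "0 < soddy (1 / r a) (1 / r b) (1 / r c) (1 / r t)" using disc by simp
  define W where "W i j = facet_sum r \<tau> i j / (r i + r j)" for i j
  have W_sym: "W i j = W j i" for i j
    by (simp add: W_def facet_sum_def insert_commute add.commute)
  have diffs: "\<tau> - {a} = {b, c, t}" "\<tau> - {b} = {a, c, t}" "\<tau> - {c} = {a, b, t}" "\<tau> - {t} = {a, b, c}"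
    using dist by (auto simp: \<tau>)
  have "energy r \<tau> x = (\<Sum>i\<in>{a, b, c, t}. \<Sum>j\<in>\<tau> - {i}. W i j * (x i - x j)\<^sup>2)"
    unfolding energy_def W_def by (simp only: \<tau>)
  also have "\<dots> = 2 * (W a b * (x a - x b)\<^sup>2 + W a c * (x a - x c)\<^sup>2 + W a t * (x a - x t)\<^sup>2
      + W b c * (x b - x c)\<^sup>2 + W b t * (x b - x t)\<^sup>2 + W c t * (x c - x t)\<^sup>2)"
    using dist by (simp add: diffs W_sym[of b a] W_sym[of c a] W_sym[of t a] W_sym[of c b] W_sym[of t b]
      W_sym[of t c] power2_commute[of "x b" "x a"] power2_commute[of "x c" "x a"] power2_commute[of "x t" "x a"]
      power2_commute[of "x c" "x b"] power2_commute[of "x t" "x b"] power2_commute[of "x t" "x c"])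
  finally have energy: "energy r \<tau> x = 2 * (W a b * (x a - x b)\<^sup>2 + W a c * (x a - x c)\<^sup>2
      + W a t * (x a - x t)\<^sup>2 + W b c * (x b - x c)\<^sup>2 + W b t * (x b - x t)\<^sup>2 + W c t * (x c - x t)\<^sup>2)" .
  have W_eq: "W i j = edgewt (1 / r i) (1 / r j) (1 / r k) (1 / r l) / 4"
    if "\<tau> = {i, j, k, l}" "distinct [i, j, k, l]" for i j k l
    unfolding W_def using facet_sum_eq_edgewt[OF that(2)] that r by auto
  have W: "W a b = edgewt (1 / r a) (1 / r b) (1 / r c) (1 / r t) / 4"
    "W a c = edgewt (1 / r a) (1 / r c) (1 / r b) (1 / r t) / 4"
    "W a t = edgewt (1 / r a) (1 / r t) (1 / r b) (1 / r c) / 4"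
    "W b c = edgewt (1 / r b) (1 / r c) (1 / r a) (1 / r t) / 4"
    "W b t = edgewt (1 / r b) (1 / r t) (1 / r a) (1 / r c) / 4"
    "W c t = edgewt (1 / r c) (1 / r t) (1 / r a) (1 / r b) / 4"
    using dist by (intro W_eq; auto simp: \<tau>)+
  have kpos: "0 < 1 / r a" "0 < 1 / r b" "0 < 1 / r c" "0 < 1 / r t" using pos by simp_all
  note form = tetrahedron_form_definite[OF kpos s, of "x a" "x b" "x c" "x t"]
  have scale: "2 * (A / 4 * A' + B / 4 * B' + C / 4 * C' + D / 4 * D' + E / 4 * E' + F / 4 * F')
      = (A * A' + B * B' + C * C' + D * D' + E * E' + F * F') / 2"
    for A A' B B' C C' D D' E E' F F' :: real
    by (simp add: field_simps)
  show "0 \<le> energy r \<tau> x"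
    unfolding energy W scale using form(1) by simp
  show "x i = x j" if "energy r \<tau> x \<le> 0" "i \<in> \<tau>" "j \<in> \<tau>"
  proof -
    have "x a = x b \<and> x a = x c \<and> x a = x t"
      using that(1) form(2) unfolding energy W scale by simp
    then show ?thesis using that(2,3) by (auto simp: \<tau>)
  qed
qed

text \<open>Row sums vanish, and adding the double sum to its transpose produces the squares of the
  differences.\<close>

lemma weighted_laplacian_form:
  fixes L :: "real^'v::finite^'v" and w :: "'v \<Rightarrow> 'v \<Rightarrow> real"
  assumes L: "\<And>i j. L $ i $ j = (if i = j then - (\<Sum>k\<in>UNIV. w i k) else w i j)"
    and sym: "\<And>i j. w i j = w j i" and diag: "\<And>i. w i i = 0"
  shows "x \<bullet> (L *v x) = - (\<Sum>i\<in>UNIV. \<Sum>j\<in>UNIV. w i j * (x $ i - x $ j)\<^sup>2) / 2"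
    and "L *v vec c = 0"
proof -
  have Lx: "(L *v x) $ i = (\<Sum>j\<in>UNIV. w i j * (x $ j - x $ i))" for i and x :: "real^'v"
  proof -
    have "(L *v x) $ i = (\<Sum>j\<in>UNIV. w i j * x $ j - (if i = j then (\<Sum>k\<in>UNIV. w i k) * x $ i else 0))"
      unfolding matrix_vector_mult_def by (auto simp: L diag intro!: sum.cong)
    also have "\<dots> = (\<Sum>j\<in>UNIV. w i j * (x $ j - x $ i))"
      by (simp add: sum_subtractf right_diff_distrib sum_distrib_right)
    finally show ?thesis .
  qed
  then show "L *v vec c = 0" by (simp add: vec_eq_iff)
  define S where "S = (\<Sum>i\<in>UNIV. \<Sum>j\<in>UNIV. w i j * (x $ i * (x $ j - x $ i)))"
  have form: "x \<bullet> (L *v x) = S"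
    unfolding S_def by (simp add: inner_vec_def Lx sum_distrib_left ac_simps)
  have S': "S = (\<Sum>i\<in>UNIV. \<Sum>j\<in>UNIV. w i j * (x $ j * (x $ i - x $ j)))"
    unfolding S_def by (subst sum.swap) (simp add: sym[of _ _])
  have "S + S = (\<Sum>i\<in>UNIV. \<Sum>j\<in>UNIV. - (w i j * (x $ i - x $ j)\<^sup>2))"
    by (subst (2) S', unfold S_def sum.distrib[symmetric])
      (intro sum.cong refl, simp add: power2_eq_square algebra_simps)
  then show "x \<bullet> (L *v x) = - (\<Sum>i\<in>UNIV. \<Sum>j\<in>UNIV. w i j * (x $ i - x $ j)\<^sup>2) / 2"
    unfolding form sum_negf by simp
qed

section \<open>Assembling the tetrahedra of a sphere packing complex\<close>

locale packed_complex =
  fixes T :: "'v::finite set set" and d :: "'v \<Rightarrow> 'v \<Rightarrow> real" and r :: "'v \<Rightarrow> real"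
  assumes complex: "vertex_complex T" and r_pos: "0 < r v"
    and d_eq: "{i, j} \<in> simplices T 1 \<Longrightarrow> d i j = r i"
    and realizable: "\<sigma> \<in> T \<Longrightarrow> \<exists>p. euclidean_simplex d \<sigma> p"
begin

lemma face: "\<sigma> \<in> T \<Longrightarrow> \<rho> \<subseteq> \<sigma> \<Longrightarrow> \<rho> \<noteq> {} \<Longrightarrow> \<rho> \<in> T"
  using complex by (auto simp: vertex_complex_def)

lemma edge: "\<sigma> \<in> T \<Longrightarrow> i \<in> \<sigma> \<Longrightarrow> j \<in> \<sigma> \<Longrightarrow> i \<noteq> j \<Longrightarrow> {i, j} \<in> simplices T 1"
  using face[of \<sigma> "{i, j}"] by (simp add: simplices_def)

lemma edge_length_eq: "{i, j} \<in> simplices T 1 \<Longrightarrow> edge_length d i j = r i + r j"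
  using d_eq[of i j] d_eq[of j i] by (simp add: edge_length_def insert_commute)

text \<open>Affinely independent points in \<open>real^3\<close> number at most four.\<close>

lemma card_le: 
  assumes "\<sigma> \<in> T"
  shows "card \<sigma> \<le> 4"
proof -
  obtain p where "euclidean_simplex d \<sigma> p"
    using realizable[OF assms] by blast
  then have p: "inj_on p \<sigma>" "\<not> affine_dependent (p ` \<sigma>)"
    by (simp_all add: euclidean_simplex_def)
  from p(2) have "int (card (p ` \<sigma>)) = aff_dim (p ` \<sigma>) + 1"
    using aff_dim_affine_independent by fastforce
  also have "\<dots> \<le> 4"
    using aff_dim_le_DIM[of "p ` \<sigma>"] by simp
  finally show ?thesis using p(1) by (simp add: card_image)
qed

lemma disc_pos: "\<tau> \<in> simplices T 3 \<Longrightarrow> 0 < disc r \<tau>"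
  using signed_dist_tetrahedron(1)[OF realizable, of \<tau> r] r_pos d_eq edge
  by (fastforce simp: simplices_def)

definition scale :: "'v set \<Rightarrow> real" where
  "scale \<tau> = 2 * sqrt 2 / sqrt (disc r \<tau>)"

lemma scale_pos: "\<tau> \<in> simplices T 3 \<Longrightarrow> 0 < scale \<tau>"
  using disc_pos by (simp add: scale_def)

text \<open>The roots of the facet discriminant in the two distances combine, leaving a rational
  expression times a factor depending on \<open>\<tau>\<close> alone.\<close>

lemma signed_dist_product:
  assumes \<tau>: "\<tau> \<in> simplices T 3" and ij: "i \<in> \<tau>" "j \<in> \<tau>" "i \<noteq> j" and v: "v \<in> \<tau> - {i, j}"
  shows "signed_dist d {i, j} (\<tau> - {v}) * signed_dist d (\<tau> - {v}) \<tau>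
    = scale \<tau> * (dev r \<tau> v / disc r (\<tau> - {v}))"
proof -
  have \<tau>T: "\<tau> \<in> T" "card \<tau> = 4" using \<tau> by (auto simp: simplices_def)
  have \<sigma>T: "\<tau> - {v} \<in> T" using face[OF \<tau>T(1), of "\<tau> - {v}"] ij v by auto
  have c: "card (\<tau> - {v}) = 3" using \<tau>T v by simp
  have "signed_dist d {i, j} (\<tau> - {v}) = sqrt (2 / disc r (\<tau> - {v}))"
    using ij v c by (intro signed_dist_triangle realizable \<sigma>T r_pos d_eq edge[OF \<sigma>T]) auto
  moreover have "signed_dist d (\<tau> - {v}) \<tau> = sqrt 2 * sqrt 2 * dev r \<tau> v / (sqrt (disc r \<tau>) * sqrt (disc r (\<tau> - {v})))"
    using v by (intro signed_dist_tetrahedron(2) realizable \<tau>T r_pos d_eq edge[OF \<tau>T(1)]) auto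
  moreover have "0 < disc r (\<tau> - {v})"
    using disc_pos[OF \<tau>] disc_facet[OF \<tau>T(2), of v r] v by (simp add: add_pos_nonneg)
  moreover have "sqrt (2 / D) * (sqrt 2 * sqrt 2 * y / (q * sqrt D)) = 2 * sqrt 2 / q * (y / D)"
    if "0 < D" for D y q :: real
  proof -
    define e where "e = sqrt D"
    have e: "0 < e" "D = e * e"
      using that by (simp_all add: e_def)
    show ?thesis
      unfolding real_sqrt_divide e_def[symmetric] using e by (simp add: field_simps)
  qed
  ultimately show ?thesis by (simp only: scale_def)
qed

text \<open>Pairs of a face and a tetrahedron at the edge correspond to pairs of the tetrahedron and
  its vertex opposite to the face.\<close>

lemma dual_area_eq:
  assumes "i \<noteq> j"
  shows "dual_area T d i j
    = (\<Sum>\<tau>\<in>simplices T 3. if i \<in> \<tau> \<and> j \<in> \<tau> then scale \<tau> / 2 * facet_sum r \<tau> i j else 0)"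
proof -
  define A where "A = {\<tau> \<in> simplices T 3. i \<in> \<tau> \<and> j \<in> \<tau>}"
  define f where "f = (\<lambda>(\<tau>, v). (\<tau> - {v}, \<tau> :: 'v set))"
  have inj: "inj_on f (SIGMA \<tau>:A. \<tau> - {i, j})"
    by (auto simp: inj_on_def f_def)
  have img: "{(\<sigma>, \<tau>). \<sigma> \<in> simplices T 2 \<and> \<tau> \<in> simplices T 3 \<and> {i, j} \<subseteq> \<sigma> \<and> \<sigma> \<subseteq> \<tau>}
      = f ` (SIGMA \<tau>:A. \<tau> - {i, j})" (is "?P = ?F")
  proof (intro set_eqI iffI)
    fix z assume "z \<in> ?P"
    then obtain \<sigma> \<tau> where z: "z = (\<sigma>, \<tau>)" "\<sigma> \<in> simplices T 2" "\<tau> \<in> simplices T 3" "{i, j} \<subseteq> \<sigma>" "\<sigma> \<subseteq> \<tau>"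
      by auto
    then have "card (\<tau> - \<sigma>) = 1" by (simp add: card_Diff_subset simplices_def)
    then obtain v where "\<tau> - \<sigma> = {v}" by (metis card_1_singletonE)
    then have "\<sigma> = \<tau> - {v}" "v \<in> \<tau> - {i, j}" using z by auto
    then show "z \<in> ?F" using z by (auto simp: A_def f_def image_iff)
  next
    fix z assume "z \<in> ?F"
    then obtain \<tau> v where z: "z = (\<tau> - {v}, \<tau>)" "\<tau> \<in> A" "v \<in> \<tau> - {i, j}"
      by (auto simp: f_def)
    then have "\<tau> - {v} \<in> T"
      using face[of \<tau> "\<tau> - {v}"] by (auto simp: A_def simplices_def)
    then show "z \<in> ?P" using z by (auto simp: A_def simplices_def)
  qed
  have "dual_area T d i j = (1/2) * (\<Sum>(\<tau>, v)\<in>(SIGMA \<tau>:A. \<tau> - {i, j}).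
      signed_dist d {i, j} (\<tau> - {v}) * signed_dist d (\<tau> - {v}) \<tau>)"
    unfolding dual_area_def img sum.reindex[OF inj] by (simp add: f_def case_prod_unfold)
  also have "\<dots> = (1/2) * (\<Sum>\<tau>\<in>A. \<Sum>v\<in>\<tau> - {i, j}. signed_dist d {i, j} (\<tau> - {v}) * signed_dist d (\<tau> - {v}) \<tau>)"
    by (subst sum.Sigma) auto
  also have "\<dots> = (1/2) * (\<Sum>\<tau>\<in>A. \<Sum>v\<in>\<tau> - {i, j}. scale \<tau> * (dev r \<tau> v / disc r (\<tau> - {v})))"
    using assms by (intro arg_cong2[where f = "(*)"] sum.cong refl signed_dist_product) (auto simp: A_def)
  also have "\<dots> = (\<Sum>\<tau>\<in>A. scale \<tau> / 2 * facet_sum r \<tau> i j)"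
    by (simp add: facet_sum_def sum_distrib_left)
  also have "\<dots> = (\<Sum>\<tau>\<in>simplices T 3. if i \<in> \<tau> \<and> j \<in> \<tau> then scale \<tau> / 2 * facet_sum r \<tau> i j else 0)"
    unfolding A_def by (rule sum.inter_filter) simp
  finally show ?thesis .
qed

definition weight :: "'v \<Rightarrow> 'v \<Rightarrow> real" where
  "weight i j = (if {i, j} \<in> simplices T 1 then dual_area T d i j / edge_length d i j else 0)"

lemma weight_diag: "weight i i = 0"
  by (simp add: weight_def simplices_def)

text \<open>The formula also covers pairs that are not edges, since these lie in no
  tetrahedron.\<close>

lemma weight_eq:
  "weight i j = (\<Sum>\<tau>\<in>simplices T 3. if i \<in> \<tau> \<and> j \<in> \<tau> - {i} then scale \<tau> / 2 * (facet_sum r \<tau> i j / (r i + r j)) else 0)"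
proof (cases "{i, j} \<in> simplices T 1")
  case True
  then have "i \<noteq> j" by (auto simp: simplices_def)
  then show ?thesis
    using True by (simp add: weight_def dual_area_eq edge_length_eq sum_divide_distrib if_distrib[of "\<lambda>x. x / _"] cong: if_cong)
next
  case False
  then have "\<not> (i \<in> \<tau> \<and> j \<in> \<tau> - {i})" if "\<tau> \<in> simplices T 3" for \<tau>
  proof -
    have "\<tau> \<in> T" using that by (simp add: simplices_def)
    then show ?thesis using edge False by blast
  qed
  then show ?thesis
    using False unfolding weight_def by (subst sum.neutral) auto
qed

lemma weight_sym: "weight i j = weight j i"
  unfolding weight_eq by (intro sum.cong refl) (auto simp: facet_sum_def insert_commute add.commute)

lemma laplacian_nth:
  "laplacian T d $ i $ j = (if i = j then - (\<Sum>k\<in>UNIV. weight i k) else weight i j)"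
proof -
  have "(\<Sum>k\<in>{k. {i, k} \<in> simplices T 1}. dual_area T d i k / edge_length d i k) = (\<Sum>k\<in>UNIV. weight i k)"
    unfolding weight_def by (simp add: sum.If_cases)
  then show ?thesis
    unfolding laplacian_def by (cases "i = j") (simp_all, simp add: weight_def)
qed

lemma weight_energy:
  "(\<Sum>i\<in>UNIV. \<Sum>j\<in>UNIV. weight i j * (x i - x j)\<^sup>2) = (\<Sum>\<tau>\<in>simplices T 3. scale \<tau> / 2 * energy r \<tau> x)"
proof -
  define g where "g \<tau> i j = scale \<tau> / 2 * (facet_sum r \<tau> i j / (r i + r j)) * (x i - x j)\<^sup>2" for \<tau> i j
  have "(\<Sum>i\<in>UNIV. \<Sum>j\<in>UNIV. weight i j * (x i - x j)\<^sup>2)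
      = (\<Sum>i\<in>UNIV. \<Sum>j\<in>UNIV. \<Sum>\<tau>\<in>simplices T 3. if i \<in> \<tau> \<and> j \<in> \<tau> - {i} then g \<tau> i j else 0)"
    unfolding weight_eq sum_distrib_right g_def by (intro sum.cong refl) auto
  also have "\<dots> = (\<Sum>i\<in>UNIV. \<Sum>\<tau>\<in>simplices T 3. \<Sum>j\<in>UNIV. if i \<in> \<tau> \<and> j \<in> \<tau> - {i} then g \<tau> i j else 0)"
    by (intro sum.cong refl) (rule sum.swap)
  also have "\<dots> = (\<Sum>\<tau>\<in>simplices T 3. \<Sum>i\<in>UNIV. \<Sum>j\<in>UNIV. if i \<in> \<tau> \<and> j \<in> \<tau> - {i} then g \<tau> i j else 0)"
    by (rule sum.swap)
  also have "\<dots> = (\<Sum>\<tau>\<in>simplices T 3. \<Sum>i\<in>UNIV. if i \<in> \<tau> then \<Sum>j\<in>\<tau> - {i}. g \<tau> i j else 0)"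
  proof (intro sum.cong refl)
    fix \<tau> and i :: 'v
    show "(\<Sum>j\<in>UNIV. if i \<in> \<tau> \<and> j \<in> \<tau> - {i} then g \<tau> i j else 0)
        = (if i \<in> \<tau> then \<Sum>j\<in>\<tau> - {i}. g \<tau> i j else 0)"
    proof (cases "i \<in> \<tau>")
      case True
      have "(\<Sum>j\<in>\<tau> - {i}. g \<tau> i j) = (\<Sum>j\<in>UNIV. if j \<in> \<tau> - {i} then g \<tau> i j else 0)"
        using sum.inter_restrict[of UNIV "g \<tau> i" "\<tau> - {i}"] by simp
      with True show ?thesis by simp
    qed simp
  qed
  also have "\<dots> = (\<Sum>\<tau>\<in>simplices T 3. \<Sum>i\<in>\<tau>. \<Sum>j\<in>\<tau> - {i}. g \<tau> i j)"
    by (simp add: sum.If_cases)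
  also have "\<dots> = (\<Sum>\<tau>\<in>simplices T 3. scale \<tau> / 2 * energy r \<tau> x)"
    by (simp add: energy_def sum_distrib_left g_def mult.assoc)
  finally show ?thesis .
qed

lemma laplacian_form:
  "x \<bullet> (laplacian T d *v x) = - (\<Sum>\<tau>\<in>simplices T 3. scale \<tau> / 2 * energy r \<tau> (($) x)) / 2"
  using weighted_laplacian_form(1)[OF laplacian_nth weight_sym weight_diag, of x] weight_energy[of "($) x"]
  by simp

lemma energy_term_nonneg: "\<tau> \<in> simplices T 3 \<Longrightarrow> 0 \<le> scale \<tau> / 2 * energy r \<tau> x"
  using scale_pos[of \<tau>] disc_pos[of \<tau>] energy_definite(1)[of \<tau> r x] r_pos
  by (simp add: simplices_def)

lemma laplacian_negative_semidefinite: "negative_semidefinite (laplacian T d)"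
proof -
  have "0 \<le> (\<Sum>\<tau>\<in>simplices T 3. scale \<tau> / 2 * energy r \<tau> x)" for x
    by (intro sum_nonneg energy_term_nonneg)
  then have "x \<bullet> (laplacian T d *v x) \<le> 0" for x
    unfolding laplacian_form by simp
  then show ?thesis
    using weight_sym by (simp add: negative_semidefinite_def vec_eq_iff transpose_def laplacian_nth)
qed

text \<open>A vanishing sum of nonnegative energies forces every one of them to vanish.\<close>

lemma laplacian_kernel_constant_on_tetrahedra:
  assumes "laplacian T d *v x = 0" "\<tau> \<in> simplices T 3" "i \<in> \<tau>" "j \<in> \<tau>"
  shows "x $ i = x $ j"
proof -
  have "(\<Sum>\<tau>\<in>simplices T 3. scale \<tau> / 2 * energy r \<tau> (($) x)) = 0"
    using laplacian_form[of x] assms(1) by simp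
  then have "scale \<tau> / 2 * energy r \<tau> (($) x) = 0"
    using energy_term_nonneg assms(2) by (subst (asm) sum_nonneg_eq_0_iff) auto
  then have "energy r \<tau> (($) x) \<le> 0"
    using scale_pos[OF assms(2)] by simp
  then show ?thesis
    using energy_definite(2)[of \<tau> r "($) x" i j] disc_pos[OF assms(2)] assms r_pos
    by (simp add: simplices_def)
qed

end

theorem theorem41:
  fixes M :: "'m topology"
    and T :: "'v::finite set set"
    and d :: "'v \<Rightarrow> 'v \<Rightarrow> real"
  assumes "topological_manifold 3 M" and "connected_space M"
    and "triangulates T M"
    and "sphere_packing T d"
  shows "negative_semidefinite (laplacian T d) \<and>
         {x. laplacian T d *v x = 0} = span {vec c | c. True}"
proof -
  obtain r where "\<And>v. 0 < r v" "\<And>i j. {i, j} \<in> simplices T 1 \<Longrightarrow> d i j = r i"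
    using assms(4) by (auto simp: sphere_packing_def)
  then interpret packed_complex T d r
    using assms(3,4) by unfold_locales (auto simp: sphere_packing_def triangulates_def)
  have conn: "connected (polyhedron_of T)"
    using assms(2,3) homeomorphic_connected_space[of "top_of_set (polyhedron_of T)" M]
    by (simp add: triangulates_def flip: connectedin_iff_connected) (simp add: connectedin_def)
  have "subspace {vec c :: real^'v | c. True}"
    by (auto simp: subspace_def vec_eq_iff intro: exI[of _ "_ + _"] exI[of _ "_ * _"])
  then have span: "span {vec c :: real^'v | c. True} = {vec c | c. True}"
    by (simp only: span_eq_iff)
  have "x \<in> {vec c | c. True}" if x: "laplacian T d *v x = 0" for x
  proof -
    have "x $ i = x $ j" if "{i, j} \<in> simplices T 1" for i j
    proof -
      have "{i, j} \<in> T"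
        using that by (simp add: simplices_def)
      then obtain \<tau> where "\<tau> \<in> simplices T 3" "{i, j} \<subseteq> \<tau>"
        using manifold_simplex_in_3_simplex[OF assms(1,3) card_le, of "{i, j}"] by blast
      then show ?thesis
        using laplacian_kernel_constant_on_tetrahedra[OF x] by simp
    qed
    then have "x $ i = x $ j" for i j
      by (rule constant_if_constant_on_edges[OF complex conn])
    \<comment> \<open>Here \<open>undefined\<close> is merely some vertex; any coordinate serves as
      the constant.\<close>
    then have "x = vec (x $ undefined)"
      by (simp add: vec_eq_iff)
    then show ?thesis by blast
  qed
  moreover have "laplacian T d *v vec c = 0" for c
    by (rule weighted_laplacian_form(2)[OF laplacian_nth weight_sym weight_diag])
  ultimately have "{x. laplacian T d *v x = 0} = {vec c | c. True}"
    by blast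
  then show ?thesis
    unfolding span using laplacian_negative_semidefinite by blast
qed

end
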